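(* Let $0<q<1$, and let all complex parameters below be such that no denominator vanishes. If $|c/(ab)|<1$, then $$\sum_{n=0}^{\infty}\frac{(b;q)_{n}q^{n^{2}/2}S_{n}(aq^{-n-1/2};q)}{(c;q)_{n}}\left(\frac{c}{ab}\right)^{n}=\frac{(c/b;q)_{\infty}}{(c;q)_{\infty}}\sum_{n=0}^{\infty}\frac{q^{n^{2}/2}}{(q;q)_{n}}\left(\frac{c}{ab}\right)^{n}A_{q}\left(\frac{cq^{n-1/2}}{a}\right).$$ In particular, for $|cz|<q^{1/2}$, $$\sum_{n=0}^{\infty}\frac{q^{\binom{n}{2}}}{(q;q)_{n}}(cz)^{n}A_{q}(cq^{n-1})=\frac{(c;q)_{\infty}}{(cz;q)_{\infty}}\sum_{n=0}^{\infty}\frac{q^{n^{2}}\prod_{j=0}^{2n-1}(z-q^{j})\,(-c^{2})^{n}}{(q^{2},c,cq;q^{2})_{n}},$$ and $$A_{q}(c)=\sum_{n=0}^{\infty}\frac{q^{3n^{2}+n}(-c^{2})^{n}}{(q^{2},cq,cq^{2};q^{2})_{n}}.$$ Similarly, for $|c^{2}z|<q^{-1}$, $$\sum_{n=0}^{\infty}\frac{q^{n^{2}+n}(-c^{2}z)^{n}}{(q^{2};q^{2})_{n}}A_{q^{2}}(-c^{2}q^{2n})=\frac{(c^{2}q;q^{2})_{\infty}}{(c^{2}zq;q^{2})_{\infty}}\sum_{n=0}^{\infty}\frac{q^{\binom{n+1}{2}}\prod_{j=0}^{n-1}(z-q^{2j})\,(-c^{2})^{n}}{(q,cq^{1/2},-cq^{1/2};q)_{n}},$$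 and $$A_{q^{2}}(-c^{2})=(c^{2}q;q^{2})_{\infty}\sum_{n=0}^{\infty}\frac{q^{(3n^{2}-n)/2}c^{2n}}{(q,cq^{1/2},-cq^{1/2};q)_{n}}.$$
   Context: Notation: for a base $p$ with $|p|<1$, $(a;p)_\infty=\prod_{k\ge0}(1-ap^k)$, $(a;p)_n=\prod_{k=0}^{n-1}(1-ap^k)$, and $(a_1,\dots,a_r;p)_n=\prod_i (a_i;p)_n$. The Ramanujan function with base $p$ is $A_p(x)=\sum_{n=0}^\infty \frac{p^{n^2}}{(p;p)_n}(-x)^n$. The Stieltjes--Wigert polynomials are $S_n(x;q)=\sum_{k=0}^n\frac{q^{k^2}}{(q;q)_k(q;q)_{n-k}}(-x)^k$. Empty products equal $1$.
   Formalization: Two displayed formulas are false as printed and are corrected: in the second identity q^{n^2} becomes q^{n^2-n}; in the third, q^{3n^2+n} becomes q^{3n^2} and the factor (cq;q)_∞ is put before the sum. *)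

theory Defs
  imports "HOL-Analysis.Analysis"
begin

definition qpoch :: "complex \<Rightarrow> complex \<Rightarrow> nat \<Rightarrow> complex" where
  "qpoch a p n = (\<Prod>k<n. 1 - a * p ^ k)"

definition qpoch_inf :: "complex \<Rightarrow> complex \<Rightarrow> complex" where
  "qpoch_inf a p = (\<Prod>k. 1 - a * p ^ k)"

text \<open>The multi-parameter symbol \<open>(a\<^sub>1, \<dots>, a\<^sub>r; p)\<^sub>n\<close>; the parameters are given as a list.\<close>

definition qpochs :: "complex list \<Rightarrow> complex \<Rightarrow> nat \<Rightarrow> complex" where
  "qpochs as p n = prod_list (map (\<lambda>a. qpoch a p n) as)"

definition ramanujan_A :: "complex \<Rightarrow> complex \<Rightarrow> complex" where
  "ramanujan_A p x = (\<Sum>n. p ^ (n ^ 2) / qpoch p p n * (- x) ^ n)"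

definition stieltjes_wigert :: "nat \<Rightarrow> complex \<Rightarrow> complex \<Rightarrow> complex" where
  "stieltjes_wigert n x q =
     (\<Sum>k\<le>n. q ^ (k ^ 2) / (qpoch q q k * qpoch q q (n - k)) * (- x) ^ k)"

text \<open>
  An identity between two infinite series, up to a constant factor, including the
  convergence of both series (\<open>suminf\<close> is an unspecified value on divergent ones).
\<close>

definition series_identity :: "(nat \<Rightarrow> complex) \<Rightarrow> complex \<Rightarrow> (nat \<Rightarrow> complex) \<Rightarrow> bool" where
  "series_identity f C g \<longleftrightarrow> summable f \<and> summable g \<and> (\<Sum>n. f n) = C * (\<Sum>n. g n)"

text \<open>
  Two of the identities for the Ramanujan function with base \<open>q\<close> are misprinted in the source.
  The second one is printed with the power \<open>q\<close> to the \<open>n\<^sup>2\<close> in place of \<open>n\<^sup>2 - n\<close> on the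
  right-hand side. The third one, its case \<open>z = 0\<close> with \<open>cq\<close> for \<open>c\<close>, is accordingly printed
  with \<open>3n\<^sup>2 + n\<close> in place of \<open>3n\<^sup>2\<close>, and without the factor \<open>(cq; q)\<^sub>\<infinity>\<close>. Both are false as
  printed: at \<open>z = 0\<close> the coefficients of \<open>c\<^sup>2\<close> in the second disagree, and in the third the
  right-hand side has no term linear in \<open>c\<close>. The theorem states the corrected
  identities, which are the specialisations \<open>a = q\<^sup>1\<^sup>/\<^sup>2\<close>, \<open>b = 1/z\<close> of the first one.
\<close>

end

theory Submission
  imports Defs
begin

text \<open>
  All five identities are instances of one. Let \<open>e\<^sub>n\<close>, which is \<open>q\<close> to the power \<open>n choose 2\<close>
  divided by \<open>(q; q)\<^sub>n\<close>, be the coefficients in Euler's expansion of \<open>(-x; q)\<^sub>\<infinity>\<close>, and let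
  \<open>P\<^sub>n(z) = (z - 1) (z - q) \<dots>\<close> with \<open>n\<close> factors. This is \<open>z\<^bsup>n\<^esup> (1/z; q)\<^sub>n\<close>, but it also makes
  sense at \<open>z = 0\<close>. With three free parameters \<open>c\<close>, \<open>z\<close>, \<open>u\<close> put

    \<^item> \<open>L = \<Sum>\<^sub>n P\<^sub>n(z) e\<^sub>n u\<^bsup>n\<^esup>\<close>,
    \<^item> \<open>R = \<Sum>\<^sub>n e\<^sub>n (u z)\<^bsup>n\<^esup> A\<^sub>q(u q\<^bsup>n-1\<^esup>)\<close>,
    \<^item> \<open>D = \<Sum>\<^bsub>m,k\<^esub> P\<^bsub>m+k\<^esub>(z) / (c; q)\<^bsub>m+k\<^esub> e\<^sub>m u\<^bsup>m\<^esup> e\<^sub>k (-c)\<^bsup>k\<^esup>\<close>.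

  Then \<open>R = L\<close>: expand \<open>A\<^sub>q\<close>, sum along the diagonals, and apply the \<open>q\<close>-binomial theorem
  \<open>sum_q_binomial\<close> on each of them. Moreover \<open>D = (c z; q)\<^sub>\<infinity> / (c; q)\<^sub>\<infinity> L\<close>: for fixed \<open>m\<close> the sum
  over \<open>k\<close> is the summable \<open>\<^sub>1\<phi>\<^sub>1\<close> series of \<open>phi11_sums\<close>. The \<open>e\<^sub>n\<close> decay faster than any geometric
  sequence, so all double series converge absolutely and \<open>sums_diagonal\<close> permits the
  rearrangements. Eliminating \<open>L\<close>, with \<open>D\<close> also arranged by the diagonals \<open>n = m + k\<close>, gives
  \<open>ramanujan_A_double_expansion\<close>.

  What remains is to recognise the finite sum of \<open>e\<^sub>m u\<^bsup>m\<^esup> e\<^sub>k (-c)\<^bsup>k\<^esup>\<close> over \<open>m + k = n\<close>: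

    \<^item> for \<open>u = c \<surd>q / a\<close> and \<open>z = 1/b\<close> it is a Stieltjes--Wigert polynomial with its powers of
      \<open>q\<close> redistributed;
    \<^item> for \<open>u = c\<close> it is a coefficient of \<open>(-c x; q)\<^sub>\<infinity> (c x; q)\<^sub>\<infinity>\<close>, the product
      \<open>(c\<^sup>2 x\<^sup>2; q\<^sup>2)\<^sub>\<infinity>\<close>, so that only even \<open>n\<close> survive (\<open>euler_conv_alternating\<close>);
    \<^item> in base \<open>q\<^sup>2\<close> with \<open>c\<^sup>2 q\<close> for \<open>c\<close> and \<open>u = - c\<^sup>2 q\<^sup>2\<close> it is a coefficient of
      \<open>(-x; q\<^sup>2)\<^sub>\<infinity> (-x q; q\<^sup>2)\<^sub>\<infinity> = (-x; q)\<^sub>\<infinity>\<close> with \<open>-c\<^sup>2 q\<close> times the variable for \<open>x\<close>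
      (\<open>euler_conv_square_base\<close>).

  The two formulas for a single \<open>A\<close> are the cases \<open>z = 0\<close>, where only the term \<open>n = 0\<close> of the
  series of Ramanujan functions is left.
\<close>

unbundle no vec_syntax
unbundle fps_syntax

section \<open>Finite and infinite \<open>q\<close>-shifted factorials\<close>

lemma qpoch_0 [simp]: "qpoch a q 0 = 1"
  by (simp add: qpoch_def)

lemma qpoch_Suc: "qpoch a q (Suc n) = qpoch a q n * (1 - a * q ^ n)"
  by (simp add: qpoch_def)

lemma qpoch_add: "qpoch a q (m + n) = qpoch a q m * qpoch (a * q ^ m) q n"
  by (induction n) (simp_all add: qpoch_Suc power_add mult.assoc)

lemma qpoch_factor_nz:
  assumes "\<And>n. qpoch c q n \<noteq> 0"
  shows "1 - c * q ^ n \<noteq> 0"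
  using assms[of "Suc n"] by (simp add: qpoch_Suc)

lemma qpoch_shift_nz:
  assumes "\<And>n. qpoch c q n \<noteq> 0"
  shows "qpoch (c * q ^ m) q n \<noteq> 0"
  using assms[of "m + n"] by (simp add: qpoch_add)

lemma qpoch_nz_norm_less_1:
  assumes "norm q < 1" "norm c < 1"
  shows "qpoch c q n \<noteq> 0"
proof -
  have "1 - c * q ^ k \<noteq> 0" for k
  proof
    assume "1 - c * q ^ k = 0"
    then have "norm (c * q ^ k) = 1" by simp
    moreover have "norm (c * q ^ k) \<le> norm c * 1"
      unfolding norm_mult norm_power
      by (intro mult_left_mono power_le_one) (use assms in auto)
    ultimately show False using assms by simp
  qed
  then show ?thesis by (simp add: qpoch_def)
qed

lemma convergent_prod_qpoch:
  fixes a q :: complex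
  assumes "norm q < 1"
  shows "convergent_prod (\<lambda>k. 1 - a * q ^ k)"
proof -
  have "summable (\<lambda>k. norm a * norm q ^ k)"
    using assms by (intro summable_mult summable_geometric) auto
  then have "summable (\<lambda>k. norm ((1 - a * q ^ k) - 1))"
    by (simp add: norm_mult norm_power)
  then show ?thesis
    by (intro abs_convergent_prod_imp_convergent_prod summable_imp_abs_convergent_prod)
qed

lemma qpoch_tendsto:
  assumes "norm q < 1"
  shows "(\<lambda>n. qpoch a q n) \<longlonglongrightarrow> qpoch_inf a q"
  using convergent_prod_LIMSEQ[OF convergent_prod_qpoch[OF assms, of a]]
  unfolding qpoch_def qpoch_inf_def by (simp add: LIMSEQ_lessThan_iff_atMost)

lemma qpoch_inf_0 [simp]: "qpoch_inf 0 q = 1"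
  by (simp add: qpoch_inf_def)

lemma qpoch_inf_nz:
  assumes "norm q < 1" "\<And>n. qpoch c q n \<noteq> 0"
  shows "qpoch_inf c q \<noteq> 0"
  unfolding qpoch_inf_def
  using convergent_prod_qpoch[OF assms(1)] qpoch_factor_nz[OF assms(2)]
  by (rule prodinf_nonzero)

lemma qpoch_inf_split:
  assumes "norm q < 1"
  shows "qpoch_inf c q = qpoch c q m * qpoch_inf (c * q ^ m) q"
proof (rule LIMSEQ_unique)
  show "(\<lambda>n. qpoch c q (m + n)) \<longlonglongrightarrow> qpoch_inf c q"
    using LIMSEQ_ignore_initial_segment[OF qpoch_tendsto[OF assms, of c], of m]
    by (simp add: add.commute)
  show "(\<lambda>n. qpoch c q (m + n)) \<longlonglongrightarrow> qpoch c q m * qpoch_inf (c * q ^ m) q"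
    unfolding qpoch_add by (intro tendsto_mult tendsto_const qpoch_tendsto assms)
qed

lemma qpoch_bounded:
  assumes "norm q < 1"
  obtains B where "B > 0" "\<And>n. norm (qpoch a q n) \<le> B"
proof -
  have "Bseq (qpoch a q)"
    using convergent_imp_Bseq convergentI qpoch_tendsto[OF assms, of a] by blast
  then show ?thesis using that by (auto simp: Bseq_def)
qed

text \<open>
  The denominators \<open>(c; q)\<^sub>n\<close> stay away from \<open>0\<close> because their limit is a convergent product of
  nonzero factors. All dominating series below rest on this uniform bound.
\<close>

lemma inverse_qpoch_bounded:
  assumes "norm q < 1" "\<And>n. qpoch c q n \<noteq> 0"
  obtains B where "B > 0" "\<And>n. norm (1 / qpoch c q n) \<le> B"
proof -
  have "(\<lambda>n. 1 / qpoch c q n) \<longlonglongrightarrow> 1 / qpoch_inf c q"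
    by (intro tendsto_divide tendsto_const qpoch_tendsto qpoch_inf_nz assms)
  then have "Bseq (\<lambda>n. 1 / qpoch c q n)"
    using convergent_imp_Bseq convergentI by blast
  then show ?thesis using that by (auto simp: Bseq_def)
qed

section \<open>Euler coefficients and their decay\<close>

text \<open>
  The coefficients of Euler's series for \<open>(-x; q)\<^sub>\<infinity>\<close>.
\<close>

definition euler_coeff :: "complex \<Rightarrow> nat \<Rightarrow> complex" where
  "euler_coeff q n = q ^ (n choose 2) / qpoch q q n"

lemma euler_coeff_0 [simp]: "euler_coeff q 0 = 1"
  by (simp add: euler_coeff_def binomial_eq_0)

lemma Suc_choose_2: "Suc n choose 2 = (n choose 2) + n"
  by (simp add: numeral_2_eq_2)

lemma one_minus_power_nz:
  fixes q :: complex
  assumes "norm q < 1"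
  shows "1 - q ^ Suc n \<noteq> 0"
  using qpoch_factor_nz[OF qpoch_nz_norm_less_1[OF assms assms], of n] by simp

text \<open>
  This recurrence is the functional equation \<open>E(x) = (1 + x) E(q x)\<close> of \<open>E(x) = (-x; q)\<^sub>\<infinity>\<close>,
  read off coefficientwise. Together with the value \<open>1\<close> at \<open>0\<close> it determines them.
\<close>

lemma euler_coeff_Suc:
  assumes "norm q < 1"
  shows "(1 - q ^ Suc n) * euler_coeff q (Suc n) = q ^ n * euler_coeff q n"
  using one_minus_power_nz[OF assms, of n]
  by (simp add: euler_coeff_def qpoch_Suc Suc_choose_2 power_add)

text \<open>
  Successive terms have a ratio that tends to \<open>0\<close>, whatever \<open>r\<close> is: this is the entire function
  \<open>(-x; q)\<^sub>\<infinity>\<close>. Hence any factor of at most geometric growth can be absorbed into \<open>r\<close>.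
\<close>

lemma summable_euler_coeff:
  assumes "norm q < 1"
  shows "summable (\<lambda>n. norm (euler_coeff q n) * r ^ n)"
proof -
  have 0: "(\<lambda>n. q ^ n) \<longlonglongrightarrow> 0"
    using assms by (rule LIMSEQ_power_zero)
  have "(\<lambda>n. of_real r * q ^ n / (1 - q ^ Suc n)) \<longlonglongrightarrow> of_real r * 0 / (1 - 0)"
    by (intro tendsto_intros 0 LIMSEQ_Suc[OF 0]) auto
  then have "(\<lambda>n. norm (of_real r * q ^ n / (1 - q ^ Suc n))) \<longlonglongrightarrow> 0"
    by (simp add: tendsto_norm_zero_iff)
  then have "eventually (\<lambda>n. norm (of_real r * q ^ n / (1 - q ^ Suc n)) < 1/2) sequentially"
    by (rule order_tendstoD) simp
  then obtain N where N: "\<And>n. n \<ge> N \<Longrightarrow> norm (of_real r * q ^ n / (1 - q ^ Suc n)) < 1/2"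
    by (auto simp: eventually_at_top_linorder)
  show ?thesis
  proof (rule summable_ratio_test[of "1/2" N])
    fix n assume "n \<ge> N"
    have "euler_coeff q (Suc n) = q ^ n * euler_coeff q n / (1 - q ^ Suc n)"
      using euler_coeff_Suc[OF assms, of n] one_minus_power_nz[OF assms, of n]
      by (simp add: field_simps)
    then have "norm (norm (euler_coeff q (Suc n)) * r ^ Suc n)
        = norm (of_real r * q ^ n / (1 - q ^ Suc n)) * norm (norm (euler_coeff q n) * r ^ n)"
      by (simp add: norm_mult norm_divide norm_power abs_mult power_abs)
    also have "\<dots> \<le> 1/2 * norm (norm (euler_coeff q n) * r ^ n)"
      using N[OF \<open>n \<ge> N\<close>] by (intro mult_right_mono) auto
    finally show "norm (norm (euler_coeff q (Suc n)) * r ^ Suc n)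
        \<le> 1/2 * norm (norm (euler_coeff q n) * r ^ n)" .
  qed simp
qed

lemma norm_prod_linear_le:
  fixes q :: complex
  assumes "norm q < 1"
  shows "norm (\<Prod>j<n. w - c * q ^ j) \<le> (norm w + norm c) ^ n"
proof -
  have "norm (w - c * q ^ j) \<le> norm w + norm c" for j
  proof -
    have "norm (c * q ^ j) \<le> norm c * 1"
      unfolding norm_mult norm_power
      by (intro mult_left_mono power_le_one) (use assms in auto)
    then show ?thesis using norm_triangle_ineq4[of w "c * q ^ j"] by simp
  qed
  then have "(\<Prod>j<n. norm (w - c * q ^ j)) \<le> (\<Prod>j<n. norm w + norm c)"
    by (intro prod_mono) auto
  then show ?thesis by (simp add: prod_norm)
qed

section \<open>Summation of double series along diagonals\<close>

text \<open>
  A product of two convergent series dominates the double series, which is therefore absolutely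
  summable over the quadrant and may be summed by rows or by diagonals.
\<close>

lemma sums_diagonal:
  fixes f :: "nat \<Rightarrow> nat \<Rightarrow> complex"
  assumes \<alpha>: "summable \<alpha>" "\<And>m. 0 \<le> \<alpha> m" and \<beta>: "summable \<beta>" "\<And>k. 0 \<le> \<beta> k"
    and bound: "\<And>m k. norm (f m k) \<le> \<alpha> m * \<beta> k"
    and rows: "\<And>m. f m sums g m"
  shows "\<exists>S. g sums S \<and> (\<lambda>n. \<Sum>k\<le>n. f (n - k) k) sums S"
proof -
  have "(\<lambda>(m, k). \<alpha> m * \<beta> k) summable_on UNIV \<times> UNIV"
  proof (rule summable_on_SigmaI)
    show "((\<lambda>k. case (m, k) of (m, k) \<Rightarrow> \<alpha> m * \<beta> k) has_sum \<alpha> m * suminf \<beta>) UNIV" for m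
      using \<beta> by (auto intro!: has_sum_cmult_right sums_nonneg_imp_has_sum summable_sums)
    show "(\<lambda>m. \<alpha> m * suminf \<beta>) summable_on UNIV"
      using \<alpha> \<beta> by (intro summable_on_cmult_left)
        (auto intro!: has_sum_imp_summable sums_nonneg_imp_has_sum summable_sums)
  qed (use \<alpha> \<beta> in auto)
  then have "(\<lambda>x. norm (case x of (m, k) \<Rightarrow> f m k)) summable_on UNIV \<times> UNIV"
    by (rule Infinite_Sum.abs_summable_on_comparison_test') (use bound in auto)
  then have "(\<lambda>(m, k). f m k) summable_on UNIV \<times> UNIV"
    by (rule Infinite_Sum.abs_summable_summable)
  then obtain S where S: "((\<lambda>(m, k). f m k) has_sum S) (UNIV \<times> UNIV)"
    by (auto simp: summable_on_def)
  have row: "(f m has_sum g m) UNIV" for m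
  proof (rule norm_summable_imp_has_sum)
    show "summable (\<lambda>k. norm (f m k))"
      by (rule summable_comparison_test'[OF summable_mult[OF \<beta>(1), of "\<alpha> m"]])
        (use bound in auto)
  qed (rule rows)
  have "(g has_sum S) UNIV"
    by (rule has_sum_SigmaD[OF S]) (use row in auto)
  moreover have "((\<lambda>n. \<Sum>k\<le>n. f (n - k) k) has_sum S) UNIV"
  proof (rule has_sum_SigmaD)
    show "((\<lambda>(n, k). f (n - k) k) has_sum S) (SIGMA n:UNIV. {..n})"
      using S
      by (subst has_sum_reindex_bij_witness[where i = "\<lambda>(m, k). (m + k, k)"
            and j = "\<lambda>(n, k). (n - k, k)" and h = "\<lambda>(m, k). f m k"
            and T = "UNIV \<times> UNIV" and s' = S]) auto
  qed (auto intro!: has_sum_finiteI)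
  ultimately show ?thesis
    by (blast intro: has_sum_imp_sums)
qed

section \<open>Convolutions of Euler coefficients\<close>


text \<open>
  A form of the \<open>q\<close>-binomial theorem. For the left-hand side \<open>s\<^sub>n\<close>, splitting
  \<open>1 - q\<^bsup>n+1\<^esup> = (1 - q\<^bsup>k\<^esup>) q\<^bsup>n+1-k\<^esup> + (1 - q\<^bsup>n+1-k\<^esup>)\<close> in the \<open>k\<close>-th term of \<open>(1 - q\<^bsup>n+1\<^esup>) s\<^bsub>n+1\<^esub>\<close>
  lets each part cancel one factor of a denominator. This gives \<open>-q\<^bsup>n\<^esup> s\<^sub>n\<close> and \<open>z s\<^sub>n\<close>
  respectively, which is the recurrence of the right-hand side.
\<close>

lemma sum_q_binomial:
  assumes "norm q < 1"
  shows "(\<Sum>k\<le>n. (-1) ^ k * euler_coeff q k * (z ^ (n - k) / qpoch q q (n - k)))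
           = (\<Prod>j<n. z - q ^ j) / qpoch q q n"
proof (induction n)
  case 0
  show ?case by simp
next
  case (Suc n)
  define b where "b k = z ^ k / qpoch q q k" for k
  define s where "s n = (\<Sum>k\<le>n. (-1) ^ k * euler_coeff q k * b (n - k))" for n
  have b_Suc: "(1 - q ^ Suc k) * b (Suc k) = z * b k" for k
    using one_minus_power_nz[OF assms, of k] by (simp add: b_def qpoch_Suc)
  let ?f = "\<lambda>k. (-1) ^ k * ((1 - q ^ k) * euler_coeff q k) * (q ^ (Suc n - k) * b (Suc n - k))"
  let ?g = "\<lambda>k. (-1) ^ k * euler_coeff q k * ((1 - q ^ (Suc n - k)) * b (Suc n - k))"
  have "(1 - q ^ Suc n) * s (Suc n) = (\<Sum>k\<le>Suc n. ?f k + ?g k)"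
    unfolding s_def sum_distrib_left
  proof (rule sum.cong)
    fix k assume "k \<in> {..Suc n}"
    then have "q ^ Suc n = q ^ k * q ^ (Suc n - k)"
      by (simp flip: power_add)
    then have "1 - q ^ Suc n = (1 - q ^ k) * q ^ (Suc n - k) + (1 - q ^ (Suc n - k))"
      by (simp add: algebra_simps)
    then show "(1 - q ^ Suc n) * ((-1) ^ k * euler_coeff q k * b (Suc n - k)) = ?f k + ?g k"
      by (simp add: algebra_simps)
  qed simp
  also have "\<dots> = (\<Sum>k\<le>Suc n. ?f k) + (\<Sum>k\<le>Suc n. ?g k)"
    by (rule sum.distrib)
  also have "(\<Sum>k\<le>Suc n. ?f k) = (\<Sum>k\<le>n. ?f (Suc k))"
    by (subst sum.atMost_Suc_shift) simp
  also have "\<dots> = (\<Sum>k\<le>n. - (q ^ n) * ((-1) ^ k * euler_coeff q k * b (n - k)))"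
  proof (rule sum.cong)
    fix k assume "k \<in> {..n}"
    then have "q ^ n = q ^ k * q ^ (n - k)"
      by (simp flip: power_add)
    then show "?f (Suc k) = - (q ^ n) * ((-1) ^ k * euler_coeff q k * b (n - k))"
      unfolding euler_coeff_Suc[OF assms] by simp
  qed simp
  also have "\<dots> = - (q ^ n) * s n"
    by (simp add: s_def sum_distrib_left)
  also have "(\<Sum>k\<le>Suc n. ?g k) = (\<Sum>k\<le>n. ?g k)"
    by simp
  also have "\<dots> = (\<Sum>k\<le>n. z * ((-1) ^ k * euler_coeff q k * b (n - k)))"
  proof (rule sum.cong)
    fix k assume "k \<in> {..n}"
    then have "Suc n - k = Suc (n - k)" by simp
    then show "?g k = z * ((-1) ^ k * euler_coeff q k * b (n - k))"
      by (simp only: b_Suc) (simp add: algebra_simps)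
  qed simp
  also have "\<dots> = z * s n"
    by (simp add: s_def sum_distrib_left)
  finally have "(1 - q ^ Suc n) * s (Suc n) = (z - q ^ n) * s n"
    by (simp add: algebra_simps)
  then have "s (Suc n) = (z - q ^ n) * s n / (1 - q ^ Suc n)"
    using one_minus_power_nz[OF assms, of n] by (metis nonzero_mult_div_cancel_left)
  moreover have "s n = (\<Prod>j<n. z - q ^ j) / qpoch q q n"
    using Suc.IH by (simp add: s_def b_def)
  ultimately have "s (Suc n) = (\<Prod>j<Suc n. z - q ^ j) / qpoch q q (Suc n)"
    by (simp add: qpoch_Suc mult_ac)
  then show ?case by (simp only: s_def b_def)
qed

text \<open>
  The formal power series of \<open>(-a x; q)\<^sub>\<infinity>\<close> in \<open>x\<close>. The scaling factor \<open>a\<close> is a parameter so that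
  the shift \<open>x \<mapsto> q x\<close> needs no composition of power series.
\<close>

definition euler_fps :: "complex \<Rightarrow> complex \<Rightarrow> complex fps" where
  "euler_fps q a = Abs_fps (\<lambda>n. euler_coeff q n * a ^ n)"

lemma euler_fps_shift:
  assumes "norm q < 1"
  shows "euler_fps q a = (1 + fps_const a * fps_X) * euler_fps q (a * q)"
proof (rule fps_ext)
  fix n
  show "euler_fps q a $ n = ((1 + fps_const a * fps_X) * euler_fps q (a * q)) $ n"
  proof (cases n)
    case 0
    then show ?thesis by (simp add: euler_fps_def ring_distribs mult.assoc)
  next
    case (Suc m)
    have "euler_coeff q (Suc m) = q ^ Suc m * euler_coeff q (Suc m) + q ^ m * euler_coeff q m"
      using euler_coeff_Suc[OF assms, of m] by (simp add: algebra_simps)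
    moreover have "((1 + fps_const a * fps_X) * euler_fps q (a * q)) $ Suc m
        = (q ^ Suc m * euler_coeff q (Suc m) + q ^ m * euler_coeff q m) * a ^ Suc m"
      by (simp add: euler_fps_def ring_distribs mult.assoc power_mult_distrib)
    ultimately show ?thesis
      by (simp add: Suc euler_fps_def)
  qed
qed

text \<open>
  A common scaling \<open>a\<close> of both factors only multiplies the \<open>n\<close>-th coefficient by the \<open>n\<close>-th power of
  \<open>a\<close>. A functional equation between a product and its shift thus becomes a recurrence for one
  sequence of coefficients.
\<close>

lemma euler_fps_mult_nth:
  "(euler_fps q (x * a) * euler_fps r (y * a)) $ n
     = a ^ n * (\<Sum>k\<le>n. euler_coeff r (n - k) * y ^ (n - k) * (euler_coeff q k * x ^ k))"
  unfolding fps_mult_nth sum_distrib_left atMost_atLeast0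
proof (rule sum.cong)
  fix k assume "k \<in> {0..n}"
  then have "a ^ n = a ^ k * a ^ (n - k)"
    by (simp flip: power_add)
  then show "euler_fps q (x * a) $ k * euler_fps r (y * a) $ (n - k)
      = a ^ n * (euler_coeff r (n - k) * y ^ (n - k) * (euler_coeff q k * x ^ k))"
    by (simp add: euler_fps_def power_mult_distrib)
qed simp

text \<open>
  The sums are the coefficients of \<open>F(x) = (x; q)\<^sub>\<infinity> (-x; q)\<^sub>\<infinity>\<close>, which satisfies
  \<open>F(x) = (1 - x\<^sup>2) F(q x)\<close>. The resulting recurrence links coefficients whose indices differ by
  two; the coefficient of \<open>x\<close> vanishes, and so do all odd ones.
\<close>

lemma euler_conv_alternating:
  assumes "norm q < 1"
  shows "(\<Sum>k\<le>2 * m. euler_coeff q (2 * m - k) * (euler_coeff q k * (-1) ^ k))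
           = q ^ (m ^ 2 - m) * (-1) ^ m / qpoch (q ^ 2) (q ^ 2) m"
    and "(\<Sum>k\<le>Suc (2 * m). euler_coeff q (Suc (2 * m) - k) * (euler_coeff q k * (-1) ^ k)) = 0"
proof -
  define G where "G n = (\<Sum>k\<le>n. euler_coeff q (n - k) * (euler_coeff q k * (-1) ^ k))" for n
  have nth: "(euler_fps q (- a) * euler_fps q a) $ n = a ^ n * G n" for a n
    using euler_fps_mult_nth[of q "-1" a q 1 n] by (simp add: G_def)
  have "euler_fps q (- 1) * euler_fps q 1
      = (1 - fps_X) * (1 + fps_X) * (euler_fps q (- q) * euler_fps q q)"
    unfolding euler_fps_shift[OF assms, of "-1"] euler_fps_shift[OF assms, of 1]
    by (simp add: mult_ac flip: fps_const_neg)
  also have "\<dots> = euler_fps q (- q) * euler_fps q q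
      - fps_X * (fps_X * (euler_fps q (- q) * euler_fps q q))"
    by (simp add: algebra_simps)
  finally have G: "G n = (euler_fps q (- q) * euler_fps q q) $ n
      - (fps_X * (fps_X * (euler_fps q (- q) * euler_fps q q))) $ n" for n
    using nth[of 1 n] by (metis fps_sub_nth mult_1 power_one)
  have X2: "(fps_X * (fps_X * (euler_fps q (- q) * euler_fps q q))) $ Suc (Suc n) = q ^ n * G n" for n
    by (simp add: nth)
  have step: "(1 - q ^ Suc (Suc n)) * G (Suc (Suc n)) = - (q ^ n * G n)" for n
    using G[of "Suc (Suc n)"] unfolding X2 nth by (simp add: algebra_simps)
  have G1: "(1 - q ^ Suc 0) * G (Suc 0) = 0"
    using G[of "Suc 0"] unfolding nth by (simp add: algebra_simps)
  have nz: "1 - q ^ Suc (Suc n) \<noteq> 0" for n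
    by (rule one_minus_power_nz[OF assms])
  show "G (Suc (2 * m)) = 0"
  proof (induction m)
    case 0
    show ?case using G1 one_minus_power_nz[OF assms, of 0] by simp
  next
    case (Suc m)
    then show ?case using step[of "Suc (2 * m)"] nz[of "Suc (2 * m)"] by simp
  qed
  show "G (2 * m) = q ^ (m ^ 2 - m) * (-1) ^ m / qpoch (q ^ 2) (q ^ 2) m"
  proof (induction m)
    case 0
    show ?case by (simp add: G_def)
  next
    case (Suc m)
    have ex: "(Suc m) ^ 2 - Suc m = 2 * m + (m ^ 2 - m)"
      by (cases m) (auto simp: power2_eq_square algebra_simps)
    have "(1 - q ^ Suc (Suc (2 * m))) * G (2 * Suc m) = - (q ^ (2 * m) * G (2 * m))"
      using step[of "2 * m"] by simp
    then have "G (2 * Suc m) = - (q ^ (2 * m) * G (2 * m)) / (1 - q ^ Suc (Suc (2 * m)))"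
      using nz[of "2 * m"] by (simp add: field_simps)
    moreover have "q ^ 2 * (q ^ 2) ^ m = q ^ (2 * Suc m)"
      by (simp only: power_mult power_Suc)
    then have "q ^ 2 * (q ^ 2) ^ m = q ^ Suc (Suc (2 * m))"
      by simp
    ultimately show ?case
      unfolding ex qpoch_Suc Suc.IH by (simp add: power_add)
  qed
qed

text \<open>
  Interleaving even and odd factors, \<open>(-x; q\<^sup>2)\<^sub>\<infinity> (-x q; q\<^sup>2)\<^sub>\<infinity> = (-x; q)\<^sub>\<infinity>\<close>. Shifting \<open>x\<close> to \<open>q x\<close>
  exchanges the two products on the left up to the factor \<open>1 + x\<close>, so their coefficients obey the
  recurrence of the Euler coefficients in base \<open>q\<close>.
\<close>

lemma euler_conv_square_base:
  assumes "norm q < 1"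
  shows "(\<Sum>k\<le>n. euler_coeff (q ^ 2) (n - k) * q ^ (n - k) * euler_coeff (q ^ 2) k) = euler_coeff q n"
proof -
  have q2: "norm (q ^ 2) < 1"
    using assms by (simp add: norm_power power_less_one_iff)
  define K where "K n = (\<Sum>k\<le>n. euler_coeff (q ^ 2) (n - k) * q ^ (n - k) * euler_coeff (q ^ 2) k)" for n
  have nth: "(euler_fps (q ^ 2) a * euler_fps (q ^ 2) (q * a)) $ n = a ^ n * K n" for a n
    using euler_fps_mult_nth[of "q ^ 2" 1 a "q ^ 2" q n] by (simp add: K_def)
  have "euler_fps (q ^ 2) 1 * euler_fps (q ^ 2) q
      = (1 + fps_X) * (euler_fps (q ^ 2) q * euler_fps (q ^ 2) (q * q))"
    unfolding euler_fps_shift[OF q2, of 1] by (simp add: mult_ac power2_eq_square)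
  also have "\<dots> = euler_fps (q ^ 2) q * euler_fps (q ^ 2) (q * q)
      + fps_X * (euler_fps (q ^ 2) q * euler_fps (q ^ 2) (q * q))"
    by (simp add: algebra_simps)
  finally have K: "K n = (euler_fps (q ^ 2) q * euler_fps (q ^ 2) (q * q)) $ n
      + (fps_X * (euler_fps (q ^ 2) q * euler_fps (q ^ 2) (q * q))) $ n" for n
    using nth[of 1 n] by (metis fps_add_nth mult_1 mult.right_neutral power_one)
  have X1: "(fps_X * (euler_fps (q ^ 2) q * euler_fps (q ^ 2) (q * q))) $ Suc n = q ^ n * K n" for n
    by (simp add: nth)
  have step: "(1 - q ^ Suc n) * K (Suc n) = q ^ n * K n" for n
    using K[of "Suc n"] unfolding X1 nth by (simp add: algebra_simps)
  have "K n = euler_coeff q n" 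
  proof (induction n)
    case 0
    show ?case by (simp add: K_def)
  next
    case (Suc n)
    have "(1 - q ^ Suc n) * K (Suc n) = q ^ n * K n"
      by (rule step)
    also have "\<dots> = (1 - q ^ Suc n) * euler_coeff q (Suc n)"
      by (simp only: Suc.IH euler_coeff_Suc[OF assms])
    finally show ?case
      using one_minus_power_nz[OF assms, of n] by (metis mult_cancel_left)
  qed
  then show ?thesis by (simp add: K_def)
qed

section \<open>The summable \<open>\<^sub>1\<phi>\<^sub>1\<close> series\<close>

text \<open>
  The terms of \<open>\<^sub>1\<phi>\<^sub>1(c/w; c; q, w)\<close>, with the powers of \<open>w\<close> multiplied into \<open>(c/w; q)\<^sub>k\<close>. This form
  is a polynomial in \<open>w\<close>, and \<open>w = 0\<close> is an admissible value; it will be needed for \<open>z = 0\<close>.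
\<close>

definition phi11_term :: "complex \<Rightarrow> complex \<Rightarrow> complex \<Rightarrow> nat \<Rightarrow> complex" where
  "phi11_term w c q k = (-1) ^ k * euler_coeff q k * (\<Prod>j<k. w - c * q ^ j) / qpoch c q k"

text \<open>
  One bound for all the series that arise from \<open>(w, c)\<close> by multiplying both parameters by powers of
  \<open>q\<close>. The factor \<open>norm q ^ (n * k)\<close> makes every term but the first vanish as \<open>n\<close> grows.
\<close>

lemma phi11_term_bounded:
  assumes "norm q < 1" "\<And>n. qpoch c q n \<noteq> 0"
  obtains B where "B \<ge> 0" "\<And>n k. norm (phi11_term (w * q ^ n) (c * q ^ n) q k)
    \<le> norm q ^ (n * k) * (B * (norm (euler_coeff q k) * (norm w + norm c) ^ k))"
proof -
  obtain B1 where B1: "B1 > 0" "\<And>n. norm (qpoch c q n) \<le> B1"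
    using qpoch_bounded[OF assms(1)] by blast
  obtain B2 where B2: "B2 > 0" "\<And>n. norm (1 / qpoch c q n) \<le> B2"
    using inverse_qpoch_bounded[OF assms] by blast
  have "norm (phi11_term (w * q ^ n) (c * q ^ n) q k)
      \<le> norm q ^ (n * k) * ((B1 * B2) * (norm (euler_coeff q k) * (norm w + norm c) ^ k))" for n k
  proof -
    have "(\<Prod>j<k. w * q ^ n - c * q ^ n * q ^ j) = (\<Prod>j<k. q ^ n * (w - c * q ^ j))"
      by (simp add: algebra_simps)
    also have "\<dots> = q ^ (n * k) * (\<Prod>j<k. w - c * q ^ j)"
      by (simp add: prod.distrib power_mult)
    finally have "phi11_term (w * q ^ n) (c * q ^ n) q k = q ^ (n * k) *
        (qpoch c q n * (1 / qpoch c q (n + k)) * ((-1) ^ k * euler_coeff q k * (\<Prod>j<k. w - c * q ^ j)))"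
      using assms(2)[of n] by (simp add: phi11_term_def qpoch_add)
    also have "norm \<dots> = norm q ^ (n * k) *
        (norm (qpoch c q n) * norm (1 / qpoch c q (n + k)) * (norm (euler_coeff q k) * norm (\<Prod>j<k. w - c * q ^ j)))"
      by (simp add: norm_mult norm_power norm_divide)
    also have "\<dots> \<le> norm q ^ (n * k) * ((B1 * B2) * (norm (euler_coeff q k) * (norm w + norm c) ^ k))"
      using B1 B2 norm_prod_linear_le[OF assms(1), of w c k]
      by (intro mult_left_mono mult_mono) auto
    finally show ?thesis .
  qed
  then show ?thesis using that[of "B1 * B2"] B1 B2 by simp
qed

lemma summable_phi11_term:
  assumes "norm q < 1" "\<And>n. qpoch c q n \<noteq> 0"
  shows "summable (phi11_term w c q)"
proof -
  obtain B where "\<And>n k. norm (phi11_term (w * q ^ n) (c * q ^ n) q k)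
    \<le> norm q ^ (n * k) * (B * (norm (euler_coeff q k) * (norm w + norm c) ^ k))"
    using phi11_term_bounded[OF assms] by metis
  from this[of 0] show ?thesis
    by (intro summable_comparison_test'[OF summable_mult[OF summable_euler_coeff[OF assms(1)]]]) auto
qed

text \<open>
  Moving from \<open>(w q, c q)\<close> back to \<open>(w, c)\<close> costs the factor \<open>(1 - w) / (1 - c)\<close>. The reason is that
  the termwise difference of the two sides telescopes: it equals \<open>U\<^sub>k - U\<^bsub>k+1\<^esub>\<close>, where \<open>U\<^sub>k\<close> is
  \<open>1 - q\<^bsup>k\<^esup>\<close> times the \<open>k\<close>-th term, and \<open>U\<close> vanishes at \<open>0\<close> and at infinity.
\<close>

lemma phi11_contiguous:
  assumes "norm q < 1" "\<And>n. qpoch c q n \<noteq> 0"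
  shows "suminf (phi11_term w c q)
           = (1 - w) / (1 - c) * suminf (phi11_term (w * q) (c * q) q)"
proof -
  let ?\<phi> = "phi11_term w c q"
  define U where "U k = (1 - q ^ k) * ?\<phi> k" for k
  have c1: "1 - c * q ^ k \<noteq> 0" for k
    by (rule qpoch_factor_nz[OF assms(2)])
  have nz': "qpoch (c * q) q n \<noteq> 0" for n
    using qpoch_shift_nz[OF assms(2), of 1 n] by simp
  have shifted: "(1 - w) / (1 - c) * phi11_term (w * q) (c * q) q k
      = q ^ k * (1 - w) / (1 - c * q ^ k) * ?\<phi> k" for k
  proof -
    have "(\<Prod>j<k. w * q - c * q * q ^ j) = (\<Prod>j<k. q * (w - c * q ^ j))"
      by (simp add: algebra_simps)
    then have num: "(\<Prod>j<k. w * q - c * q * q ^ j) = q ^ k * (\<Prod>j<k. w - c * q ^ j)"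
      by (simp add: prod.distrib)
    have "(1 - c) * qpoch (c * q) q k = qpoch c q k * (1 - c * q ^ k)"
      using qpoch_add[of c q 1 k] qpoch_Suc[of c q k] by (simp add: qpoch_Suc)
    then have den: "qpoch (c * q) q k = qpoch c q k * (1 - c * q ^ k) / (1 - c)"
      using c1[of 0] by (simp add: field_simps)
    show ?thesis
      unfolding phi11_term_def num den using c1[of 0] by (simp add: mult_ac)
  qed
  have U_Suc: "U (Suc k) = - (q ^ k * (w - c * q ^ k) / (1 - c * q ^ k)) * ?\<phi> k" for k
  proof -
    have "U (Suc k) = (-1) ^ Suc k * ((1 - q ^ Suc k) * euler_coeff q (Suc k))
        * (\<Prod>j<Suc k. w - c * q ^ j) / qpoch c q (Suc k)"
      by (simp only: U_def phi11_term_def) simp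
    then show ?thesis
      unfolding euler_coeff_Suc[OF assms(1)] by (simp add: phi11_term_def qpoch_Suc mult_ac)
  qed
  have "?\<phi> k - (1 - w) / (1 - c) * phi11_term (w * q) (c * q) q k = U k - U (Suc k)" for k
  proof -
    define A where "A = q ^ k * (1 - w) / (1 - c * q ^ k)"
    define B where "B = q ^ k * (w - c * q ^ k) / (1 - c * q ^ k)"
    have "1 - A = (1 - q ^ k) + B"
      using c1[of k] by (simp add: A_def B_def field_simps)
    then have "(1 - A) * ?\<phi> k = ((1 - q ^ k) + B) * ?\<phi> k"
      by (rule arg_cong)
    then have "?\<phi> k - A * ?\<phi> k = U k - (- B * ?\<phi> k)"
      by (simp add: U_def ring_distribs)
    then show ?thesis
      unfolding shifted U_Suc A_def B_def .
  qed
  moreover have "(\<lambda>k. U k - U (Suc k)) sums (U 0 - 0)"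
  proof (rule telescope_sums')
    have "?\<phi> \<longlonglongrightarrow> 0"
      by (intro summable_LIMSEQ_zero summable_phi11_term assms)
    moreover have "(\<lambda>k. q ^ k) \<longlonglongrightarrow> 0"
      using assms(1) by (rule LIMSEQ_power_zero)
    ultimately have "U \<longlonglongrightarrow> (1 - 0) * 0"
      unfolding U_def by (intro tendsto_intros assms)
    then show "U \<longlonglongrightarrow> 0" by simp
  qed
  moreover have "U 0 = 0" by (simp add: U_def)
  ultimately have "(\<lambda>k. ?\<phi> k - (1 - w) / (1 - c) * phi11_term (w * q) (c * q) q k) sums 0"
    by simp
  moreover have "(\<lambda>k. ?\<phi> k - (1 - w) / (1 - c) * phi11_term (w * q) (c * q) q k) sums
      (suminf ?\<phi> - (1 - w) / (1 - c) * suminf (phi11_term (w * q) (c * q) q))"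
    by (intro sums_diff sums_mult summable_sums summable_phi11_term assms nz')
  ultimately have "suminf ?\<phi> - (1 - w) / (1 - c) * suminf (phi11_term (w * q) (c * q) q) = 0"
    by (rule sums_unique2[symmetric])
  then show ?thesis by simp
qed

text \<open>
  The classical evaluation of \<open>\<^sub>1\<phi>\<^sub>1(c/w; c; q, w)\<close>. Iterating the contiguous relation extracts
  \<open>(w; q)\<^sub>n / (c; q)\<^sub>n\<close> and leaves a series with parameters \<open>w q\<^bsup>n\<^esup>\<close>, \<open>c q\<^bsup>n\<^esup>\<close>, which tends to its
  first term \<open>1\<close>.
\<close>

lemma phi11_sums:
  assumes "norm q < 1" "\<And>n. qpoch c q n \<noteq> 0"
  shows "phi11_term w c q sums (qpoch_inf w q / qpoch_inf c q)"
proof -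
  \<comment> \<open>The series after \<open>n\<close> contiguous steps; the claim concerns \<open>F 0\<close>.\<close>
  define F where "F n = suminf (phi11_term (w * q ^ n) (c * q ^ n) q)" for n
  have F0: "F 0 = qpoch w q n / qpoch c q n * F n" for n
  proof (induction n)
    case (Suc n)
    have "F n = (1 - w * q ^ n) / (1 - c * q ^ n) * F (Suc n)"
      using phi11_contiguous[OF assms(1), of "c * q ^ n" "w * q ^ n"] qpoch_shift_nz[OF assms(2)]
      by (simp add: F_def mult_ac)
    with Suc.IH show ?case by (simp add: qpoch_Suc)
  qed simp
  obtain B where B: "B \<ge> 0" "\<And>n k. norm (phi11_term (w * q ^ n) (c * q ^ n) q k)
    \<le> norm q ^ (n * k) * (B * (norm (euler_coeff q k) * (norm w + norm c) ^ k))"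
    using phi11_term_bounded[OF assms] by metis
  define M where "M k = B * (norm (euler_coeff q k) * (norm w + norm c) ^ k)" for k
  have M: "summable M"
    unfolding M_def by (intro summable_mult summable_euler_coeff assms)
  then have M': "summable (\<lambda>k. M (Suc k))" by (simp only: summable_Suc_iff)
  have "norm (F n - 1) \<le> norm q ^ n * (\<Sum>k. M (Suc k))" for n
  proof -
    let ?f = "phi11_term (w * q ^ n) (c * q ^ n) q"
    have sm: "summable ?f"
      by (intro summable_phi11_term qpoch_shift_nz assms)
    have "?f 0 = 1" by (simp add: phi11_term_def)
    then have "F n - 1 = (\<Sum>k. ?f (Suc k))"
      using suminf_split_head[OF sm] by (simp add: F_def)
    also have "norm \<dots> \<le> (\<Sum>k. norm q ^ n * M (Suc k))"
    proof (rule norm_suminf_le)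
      fix k
      have "norm q ^ (n * Suc k) \<le> norm q ^ n"
        using assms(1) by (intro power_decreasing) auto
      then have "norm q ^ (n * Suc k) * M (Suc k) \<le> norm q ^ n * M (Suc k)"
        using B(1) by (intro mult_right_mono) (auto simp: M_def)
      then show "norm (?f (Suc k)) \<le> norm q ^ n * M (Suc k)"
        using B(2)[of n "Suc k"] unfolding M_def by linarith
    qed (intro summable_mult M')
    also have "\<dots> = norm q ^ n * (\<Sum>k. M (Suc k))"
      using M' by (rule suminf_mult)
    finally show ?thesis .
  qed
  moreover have "(\<lambda>n. norm q ^ n * (\<Sum>k. M (Suc k))) \<longlonglongrightarrow> 0"
    using assms(1) by (intro tendsto_mult_left_zero LIMSEQ_power_zero) auto
  ultimately have "(\<lambda>n. F n - 1) \<longlonglongrightarrow> 0"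
    by (intro Lim_null_comparison[of "\<lambda>n. F n - 1"]) auto
  then have "F \<longlonglongrightarrow> 1"
    by (simp add: LIM_zero_iff)
  then have "(\<lambda>n. qpoch w q n / qpoch c q n * F n) \<longlonglongrightarrow> qpoch_inf w q / qpoch_inf c q * 1"
    by (intro tendsto_intros qpoch_tendsto qpoch_inf_nz assms)
  then have "(\<lambda>n. F 0) \<longlonglongrightarrow> qpoch_inf w q / qpoch_inf c q"
    by (simp only: mult_1_right flip: F0)
  then have "F 0 = qpoch_inf w q / qpoch_inf c q"
    by (simp add: LIMSEQ_const_iff)
  moreover have "phi11_term w c q sums suminf (phi11_term w c q)"
    by (intro summable_sums summable_phi11_term assms)
  ultimately show ?thesis by (simp add: F_def)
qed

lemma summable_prod_euler:
  assumes "norm q < 1"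
  shows "summable (\<lambda>n. (\<Prod>j<n. z - q ^ j) * (euler_coeff q n * u ^ n))"
proof (rule summable_comparison_test'[OF summable_euler_coeff[OF assms, of "(norm z + 1) * norm u"]])
  fix n
  show "norm ((\<Prod>j<n. z - q ^ j) * (euler_coeff q n * u ^ n))
      \<le> norm (euler_coeff q n) * ((norm z + 1) * norm u) ^ n"
    using mult_right_mono[OF norm_prod_linear_le[OF assms, of z 1 n],
        of "norm (euler_coeff q n * u ^ n)"]
    by (simp add: norm_mult norm_power power_mult_distrib mult_ac)
qed

text \<open>
  Put \<open>n = m + k\<close>. For fixed \<open>m\<close>, splitting \<open>P\<close> and \<open>(c; q)\<close> at index \<open>m\<close> turns the sum over \<open>k\<close>
  into the \<open>\<^sub>1\<phi>\<^sub>1\<close> series with parameters \<open>w = c z\<close> and \<open>c q\<^bsup>m\<^esup>\<close>. Its value is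
  \<open>(c z; q)\<^sub>\<infinity> / (c q\<^bsup>m\<^esup>; q)\<^sub>\<infinity>\<close>, whose numerator is independent of \<open>m\<close> and whose denominator
  combines with \<open>(c; q)\<^sub>m\<close> to \<open>(c; q)\<^sub>\<infinity>\<close>.
\<close>

lemma phi11_diagonal_sums:
  assumes "norm q < 1" "\<And>n. qpoch c q n \<noteq> 0"
  shows "(\<lambda>n. (\<Prod>j<n. z - q ^ j) / qpoch c q n
            * (\<Sum>k\<le>n. euler_coeff q (n - k) * u ^ (n - k) * (euler_coeff q k * (- c) ^ k)))
          sums (qpoch_inf (c * z) q / qpoch_inf c q
            * (\<Sum>n. (\<Prod>j<n. z - q ^ j) * (euler_coeff q n * u ^ n)))"
proof -
  obtain B where B: "B > 0" "\<And>n. norm (1 / qpoch c q n) \<le> B"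
    using inverse_qpoch_bounded[OF assms] by blast
  define r where "r = norm z + 1"
  have r: "r \<ge> 0" by (simp add: r_def)
  define f where "f m k = (\<Prod>j<m + k. z - q ^ j) / qpoch c q (m + k)
      * (euler_coeff q m * u ^ m * (euler_coeff q k * (- c) ^ k))" for m k
  define g where "g m = qpoch_inf (c * z) q / qpoch_inf c q
      * ((\<Prod>j<m. z - q ^ j) * (euler_coeff q m * u ^ m))" for m
  have "\<exists>S. g sums S \<and> (\<lambda>n. \<Sum>k\<le>n. f (n - k) k) sums S"
  proof (rule sums_diagonal)
    show "summable (\<lambda>m. B * (norm (euler_coeff q m) * (r * norm u) ^ m))"
      by (intro summable_mult summable_euler_coeff assms)
    show "summable (\<lambda>k. norm (euler_coeff q k) * (r * norm c) ^ k)"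
      by (intro summable_euler_coeff assms)
    show "norm (f m k) \<le> (B * (norm (euler_coeff q m) * (r * norm u) ^ m))
        * (norm (euler_coeff q k) * (r * norm c) ^ k)" for m k
    proof -
      have "norm (f m k) = norm (\<Prod>j<m + k. z - q ^ j) * norm (1 / qpoch c q (m + k))
          * norm (euler_coeff q m * u ^ m * (euler_coeff q k * (- c) ^ k))"
        by (simp add: f_def norm_mult norm_divide)
      also have "\<dots> \<le> r ^ (m + k) * B * norm (euler_coeff q m * u ^ m * (euler_coeff q k * (- c) ^ k))"
        using B r norm_prod_linear_le[OF assms(1), of z 1 "m + k"]
        by (intro mult_right_mono mult_mono) (auto simp: r_def)
      also have "\<dots> = (B * (norm (euler_coeff q m) * (r * norm u) ^ m))
        * (norm (euler_coeff q k) * (r * norm c) ^ k)"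
        by (simp add: norm_mult norm_power power_add power_mult_distrib)
      finally show ?thesis .
    qed
    show "f m sums g m" for m
    proof -
      \<comment> \<open>The factors with index at least \<open>m\<close> form a \<open>\<^sub>1\<phi>\<^sub>1\<close> term; \<open>c ^ k\<close> is absorbed into its parameters.\<close>
      have row: "f m k = (\<Prod>j<m. z - q ^ j) / qpoch c q m * (euler_coeff q m * u ^ m)
          * phi11_term (c * z) (c * q ^ m) q k" for k
      proof -
        have "(\<Prod>j<m + k. z - q ^ j) = (\<Prod>j<m. z - q ^ j) * (\<Prod>j<k. z - q ^ (m + j))"
          by (induction k) simp_all
        moreover have "(\<Prod>j<k. c * z - c * q ^ m * q ^ j) = (\<Prod>j<k. c * (z - q ^ (m + j)))"
          by (simp add: algebra_simps power_add)
        then have "(\<Prod>j<k. c * z - c * q ^ m * q ^ j) = c ^ k * (\<Prod>j<k. z - q ^ (m + j))"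
          by (simp add: prod.distrib)
        moreover have "(- c) ^ k = (-1) ^ k * c ^ k"
          by (rule power_minus)
        ultimately show ?thesis
          by (simp add: f_def phi11_term_def qpoch_add)
      qed
      have "f m sums ((\<Prod>j<m. z - q ^ j) / qpoch c q m * (euler_coeff q m * u ^ m)
          * (qpoch_inf (c * z) q / qpoch_inf (c * q ^ m) q))"
        unfolding row by (intro sums_mult phi11_sums qpoch_shift_nz assms)
      then show ?thesis
        using assms(2)[of m] by (simp add: g_def qpoch_inf_split[OF assms(1), of c m] mult_ac)
    qed
  qed (use B r in auto)
  then obtain S where S: "g sums S" "(\<lambda>n. \<Sum>k\<le>n. f (n - k) k) sums S" by blast
  have "g sums (qpoch_inf (c * z) q / qpoch_inf c q
      * (\<Sum>n. (\<Prod>j<n. z - q ^ j) * (euler_coeff q n * u ^ n)))"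
    unfolding g_def by (intro sums_mult summable_sums summable_prod_euler assms)
  then have "S = (qpoch_inf (c * z) q / qpoch_inf c q
      * (\<Sum>n. (\<Prod>j<n. z - q ^ j) * (euler_coeff q n * u ^ n)))"
    using S(1) sums_unique2 by blast
  moreover have "(\<Sum>k\<le>n. f (n - k) k) = (\<Prod>j<n. z - q ^ j) / qpoch c q n
      * (\<Sum>k\<le>n. euler_coeff q (n - k) * u ^ (n - k) * (euler_coeff q k * (- c) ^ k))" for n
    unfolding sum_distrib_left by (rule sum.cong) (auto simp: f_def)
  ultimately show ?thesis using S(2) by simp
qed

section \<open>Series of Ramanujan functions\<close>

lemma power2_eq_choose: "n ^ 2 = 2 * (n choose 2) + (n::nat)"
  by (induction n) (simp_all add: Suc_choose_2 power2_eq_square)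

lemma add_choose_2: "(m + n) choose 2 = (m choose 2) + (n choose 2) + m * n"
  by (induction n) (simp_all add: Suc_choose_2)

text \<open>
  Writing \<open>n\<^sup>2\<close> as \<open>2 (n choose 2) + n\<close> brings an Euler coefficient into the series of \<open>A\<^sub>q\<close>
  and leaves a power of \<open>x q\<close>, which explains the shift of exponent in the argument of \<open>A\<^sub>q\<close> in the
  expansions below.
\<close>

lemma ramanujan_A_sums:
  assumes "norm q < 1"
  shows "(\<lambda>k. euler_coeff q k * q ^ (k choose 2) * (- (x * q)) ^ k) sums ramanujan_A q x"
proof -
  have "summable (\<lambda>k. euler_coeff q k * q ^ (k choose 2) * (- (x * q)) ^ k)"
  proof (rule summable_comparison_test'[OF summable_euler_coeff[OF assms, of "norm (x * q)"]])
    fix k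
    have "norm q ^ (k choose 2) \<le> 1"
      using assms by (intro power_le_one) auto
    then have "norm (euler_coeff q k) * norm q ^ (k choose 2) * norm (x * q) ^ k
        \<le> norm (euler_coeff q k) * 1 * norm (x * q) ^ k"
      by (intro mult_right_mono mult_left_mono) auto
    then show "norm (euler_coeff q k * q ^ (k choose 2) * (- (x * q)) ^ k)
        \<le> norm (euler_coeff q k) * norm (x * q) ^ k"
      by (simp only: norm_mult norm_power norm_minus_cancel mult_1_right)
  qed
  moreover have "euler_coeff q k * q ^ (k choose 2) * (- (x * q)) ^ k
      = q ^ (k ^ 2) / qpoch q q k * (- x) ^ k" for k
  proof -
    have "(- (x * q)) ^ k = (- x) ^ k * q ^ k"
      by (simp flip: power_mult_distrib)
    then show ?thesis
      by (simp add: euler_coeff_def power2_eq_choose power_add mult_2)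
  qed
  ultimately show ?thesis
    by (simp add: ramanujan_A_def summable_sums)
qed

text \<open>
  The argument \<open>x n\<close> is \<open>u\<close> times \<open>q\<close> to the power \<open>n - 1\<close>, described without a negative exponent
  because it is written in a different way in each application. Since
  \<open>(m + k choose 2) = (m choose 2) + (k choose 2) + m k\<close>, the mixed power of \<open>q\<close> that comes from
  \<open>x m\<close> is just what makes the diagonal sums \<open>q\<close>-binomial.
\<close>

lemma ramanujan_A_diagonal_sums:
  assumes "norm q < 1" and x: "\<And>n. x n * q = u * q ^ n"
  shows "(\<lambda>n. euler_coeff q n * (u * z) ^ n * ramanujan_A q (x n))
    sums (\<Sum>n. (\<Prod>j<n. z - q ^ j) * (euler_coeff q n * u ^ n))"
proof -
  define f where "f n k = euler_coeff q n * (u * z) ^ n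
      * (euler_coeff q k * q ^ (k choose 2) * (- (x n * q)) ^ k)" for n k
  have "\<exists>S. (\<lambda>n. euler_coeff q n * (u * z) ^ n * ramanujan_A q (x n)) sums S
      \<and> (\<lambda>n. \<Sum>k\<le>n. f (n - k) k) sums S"
  proof (rule sums_diagonal)
    show "summable (\<lambda>n. norm (euler_coeff q n) * norm (u * z) ^ n)"
      by (intro summable_euler_coeff assms)
    show "summable (\<lambda>k. norm (euler_coeff q k) * norm u ^ k)"
      by (intro summable_euler_coeff assms)
    show "norm (f n k) \<le> (norm (euler_coeff q n) * norm (u * z) ^ n)
        * (norm (euler_coeff q k) * norm u ^ k)" for n k
    proof -
      have "norm q ^ (k choose 2) * (norm u * norm q ^ n) ^ k \<le> 1 * (norm u * 1) ^ k"
        using assms(1) by (intro mult_mono power_mono mult_left_mono power_le_one) auto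
      then have "(norm (euler_coeff q n) * norm (u * z) ^ n) * (norm (euler_coeff q k) *
          (norm q ^ (k choose 2) * (norm u * norm q ^ n) ^ k))
        \<le> (norm (euler_coeff q n) * norm (u * z) ^ n) * (norm (euler_coeff q k) * (1 * (norm u * 1) ^ k))"
        by (intro mult_left_mono) auto
      then show ?thesis
        unfolding f_def x by (simp add: norm_mult norm_power mult_ac)
    qed
    show "f n sums (euler_coeff q n * (u * z) ^ n * ramanujan_A q (x n))" for n
      unfolding f_def by (intro sums_mult ramanujan_A_sums assms)
  qed auto
  then obtain S where S: "(\<lambda>n. euler_coeff q n * (u * z) ^ n * ramanujan_A q (x n)) sums S"
    "(\<lambda>n. \<Sum>k\<le>n. f (n - k) k) sums S"
    by blast
  have "(\<Sum>k\<le>n. f (n - k) k) = (\<Prod>j<n. z - q ^ j) * (euler_coeff q n * u ^ n)" for n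
  proof -
    have "(\<Sum>k\<le>n. f (n - k) k) = (\<Sum>k\<le>n. q ^ (n choose 2) * u ^ n *
        ((-1) ^ k * euler_coeff q k * (z ^ (n - k) / qpoch q q (n - k))))"
    proof (rule sum.cong)
      fix k assume "k \<in> {..n}"
      define m where "m = n - k"
      have n: "n = m + k" using \<open>k \<in> {..n}\<close> by (simp add: m_def)
      have 1: "(- (u * q ^ m)) ^ k = (-1) ^ k * u ^ k * q ^ (m * k)"
        by (subst power_minus) (simp add: power_mult_distrib power_mult)
      show "f (n - k) k = q ^ (n choose 2) * u ^ n *
          ((-1) ^ k * euler_coeff q k * (z ^ (n - k) / qpoch q q (n - k)))"
        unfolding f_def x m_def[symmetric] n
        by (simp add: 1 euler_coeff_def add_choose_2 power_add power_mult_distrib mult_ac)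
    qed simp
    also have "\<dots> = q ^ (n choose 2) * u ^ n * ((\<Prod>j<n. z - q ^ j) / qpoch q q n)"
      by (simp only: sum_q_binomial[OF assms(1)] flip: sum_distrib_left)
    finally show ?thesis by (simp add: euler_coeff_def)
  qed
  then have "(\<Sum>n. (\<Prod>j<n. z - q ^ j) * (euler_coeff q n * u ^ n)) = S"
    using S(2) by (simp add: sums_iff)
  then show ?thesis using S(1) by simp
qed

text \<open>
  The identity behind all the others: both series are multiples of the sum of
  \<open>P\<^sub>n(z) e\<^sub>n u\<^bsup>n\<^esup>\<close>.
\<close>

lemma ramanujan_A_double_expansion:
  assumes "norm q < 1" "\<And>n. qpoch c q n \<noteq> 0" "\<And>n. x n * q = u * q ^ n"
  shows "series_identity
    (\<lambda>n. (\<Prod>j<n. z - q ^ j) / qpoch c q n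
       * (\<Sum>k\<le>n. euler_coeff q (n - k) * u ^ (n - k) * (euler_coeff q k * (- c) ^ k)))
    (qpoch_inf (c * z) q / qpoch_inf c q)
    (\<lambda>n. euler_coeff q n * (u * z) ^ n * ramanujan_A q (x n))"
  using phi11_diagonal_sums[OF assms(1,2), of z u] ramanujan_A_diagonal_sums[OF assms(1,3), of z]
  unfolding series_identity_def by (simp add: sums_iff)

lemma series_identity_flip:
  assumes "series_identity f C g" "C \<noteq> 0"
  shows "series_identity g (1 / C) f"
  using assms by (auto simp: series_identity_def)

text \<open>
  Take \<open>u = c \<surd>q / a\<close> and \<open>z = 1/b\<close>. The half-integral powers of \<open>q\<close> fit together because, for
  \<open>n = m + k\<close>, \<open>n\<^sup>2/2 + k\<^sup>2 - (n + 1/2) k = (m choose 2) + (k choose 2) + m/2\<close>.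
\<close>

lemma stieltjes_wigert_series_identity:
  fixes q :: real and Q :: complex
  assumes q: "0 < q" "q < 1" and Q: "Q = complex_of_real q"
    and "a \<noteq> 0" "b \<noteq> 0" and c: "\<And>n. qpoch c Q n \<noteq> 0"
  shows "series_identity
          (\<lambda>n. qpoch b Q n * complex_of_real (q powr (real n ^ 2 / 2))
                * stieltjes_wigert n (a * complex_of_real (q powr (- real n - 1 / 2))) Q
                / qpoch c Q n * (c / (a * b)) ^ n)
          (qpoch_inf (c / b) Q / qpoch_inf c Q)
          (\<lambda>n. complex_of_real (q powr (real n ^ 2 / 2)) / qpoch Q Q n * (c / (a * b)) ^ n
                * ramanujan_A Q (c * complex_of_real (q powr (real n - 1 / 2)) / a))"
proof -
  have Q1: "norm Q < 1" using q Q by simp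
  define s where "s = complex_of_real (q powr (1 / 2))"
  define x where "x n = c * complex_of_real (q powr (real n - 1 / 2)) / a" for n
  define u where "u = c * s / a"
  have Qpow: "Q ^ n = complex_of_real (q powr real n)" for n
    using q by (simp add: Q powr_realpow)
  have spow: "s ^ n = complex_of_real (q powr (real n / 2))" for n
    using q by (simp add: s_def powr_power flip: of_real_power)
  have choose: "real (n choose 2) = (real n ^ 2 - real n) / 2" for n
    using arg_cong[OF power2_eq_choose[of n], of real] by simp
  have x: "x n * Q = u * Q ^ n" for n
  proof -
    have "q powr (real n - 1 / 2) * q powr 1 = q powr (1 / 2) * q powr real n"
      unfolding powr_add[symmetric] by simp
    then have "complex_of_real (q powr (real n - 1 / 2)) * Q = s * Q ^ n"
      unfolding Qpow s_def using q by (simp add: Q flip: of_real_mult)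
    then show ?thesis by (simp add: x_def u_def mult_ac)
  qed
  \<comment> \<open>The half-integral powers are traded for powers of \<open>s = \<surd>q\<close>, since \<open>n\<^sup>2/2 = (n choose 2) + n/2\<close>.\<close>
  have half: "complex_of_real (q powr (real n ^ 2 / 2)) = Q ^ (n choose 2) * s ^ n" for n
    unfolding Qpow spow of_real_mult[symmetric] powr_add[symmetric] choose
    by (simp add: field_simps)
  have right: "complex_of_real (q powr (real n ^ 2 / 2)) / qpoch Q Q n * (c / (a * b)) ^ n
      = euler_coeff Q n * (u * (1 / b)) ^ n" for n
    unfolding half by (simp add: euler_coeff_def u_def power_mult_distrib power_divide)
  have left: "qpoch b Q n * complex_of_real (q powr (real n ^ 2 / 2))
        * stieltjes_wigert n (a * complex_of_real (q powr (- real n - 1 / 2))) Q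
        / qpoch c Q n * (c / (a * b)) ^ n
      = (\<Prod>j<n. 1 / b - Q ^ j) / qpoch c Q n
       * (\<Sum>k\<le>n. euler_coeff Q (n - k) * u ^ (n - k) * (euler_coeff Q k * (- c) ^ k))" for n
  proof -
    have "(\<Prod>j<n. 1 / b - Q ^ j) = (\<Prod>j<n. (1 - b * Q ^ j) * (1 / b))"
      using \<open>b \<noteq> 0\<close> by (simp add: field_simps)
    then have P: "(\<Prod>j<n. 1 / b - Q ^ j) = qpoch b Q n * (1 / b) ^ n"
      by (simp add: prod_dividef qpoch_def power_one_over)
    have S: "complex_of_real (q powr (real n ^ 2 / 2)) * (c / a) ^ n
          * stieltjes_wigert n (a * complex_of_real (q powr (- real n - 1 / 2))) Q
        = (\<Sum>k\<le>n. euler_coeff Q (n - k) * u ^ (n - k) * (euler_coeff Q k * (- c) ^ k))"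
      unfolding stieltjes_wigert_def sum_distrib_left
    proof (rule sum.cong)
      fix k assume "k \<in> {..n}"
      define m where "m = n - k"
      have n: "n = m + k" using \<open>k \<in> {..n}\<close> by (simp add: m_def)
      have "complex_of_real (q powr (real n ^ 2 / 2)) * Q ^ (k ^ 2)
            * complex_of_real (q powr (- real n - 1 / 2)) ^ k
          = complex_of_real (q powr (real n ^ 2 / 2 + real (k ^ 2) + (- real n - 1 / 2) * real k))"
        using q by (simp add: Qpow powr_add powr_power mult.commute[of "real k"] flip: of_real_mult of_real_power)
      also have "real n ^ 2 / 2 + real (k ^ 2) + (- real n - 1 / 2) * real k
          = real (m choose 2) + real (k choose 2) + real m / 2"
        unfolding choose n by (simp add: field_simps power2_eq_square)
      also have "complex_of_real (q powr (real (m choose 2) + real (k choose 2) + real m / 2))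
          = Q ^ (m choose 2) * Q ^ (k choose 2) * s ^ m"
        by (simp add: Qpow spow powr_add)
      finally have exps: "complex_of_real (q powr (real n ^ 2 / 2)) * Q ^ (k ^ 2)
            * complex_of_real (q powr (- real n - 1 / 2)) ^ k
          = Q ^ (m choose 2) * Q ^ (k choose 2) * s ^ m" .
      have "(c / a) ^ k * (- a) ^ k = (- c) ^ k"
        using \<open>a \<noteq> 0\<close> by (simp flip: power_mult_distrib)
      then have ca: "(c / a) ^ n * (- a) ^ k = (c / a) ^ m * (- c) ^ k"
        by (simp add: n power_add)
      have neg: "(- (a * y)) ^ k = (- a) ^ k * y ^ k" for y
        by (simp flip: power_mult_distrib)
      have "complex_of_real (q powr (real n ^ 2 / 2)) * (c / a) ^ n
          * (Q ^ (k ^ 2) / (qpoch Q Q k * qpoch Q Q m)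
             * (- (a * complex_of_real (q powr (- real n - 1 / 2)))) ^ k)
        = (complex_of_real (q powr (real n ^ 2 / 2)) * Q ^ (k ^ 2)
            * complex_of_real (q powr (- real n - 1 / 2)) ^ k)
          * ((c / a) ^ n * (- a) ^ k) / (qpoch Q Q k * qpoch Q Q m)"
        unfolding neg by (simp add: mult_ac)
      also have "\<dots> = euler_coeff Q m * u ^ m * (euler_coeff Q k * (- c) ^ k)"
        unfolding exps ca
        by (simp add: euler_coeff_def u_def power_mult_distrib power_divide mult_ac)
      finally show "complex_of_real (q powr (real n ^ 2 / 2)) * (c / a) ^ n
          * (Q ^ (k ^ 2) / (qpoch Q Q k * qpoch Q Q (n - k))
             * (- (a * complex_of_real (q powr (- real n - 1 / 2)))) ^ k)
        = euler_coeff Q (n - k) * u ^ (n - k) * (euler_coeff Q k * (- c) ^ k)"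
        by (simp only: m_def)
    qed simp
    then show ?thesis
      unfolding P S[symmetric] by (simp add: power_divide power_mult_distrib mult_ac)
  qed
  show ?thesis
    using ramanujan_A_double_expansion[OF Q1 c, of x u "1 / b"] x
    unfolding left right x_def[symmetric] by simp
qed

lemma qpoch_even_odd_split:
  "qpoch a q (2 * n) = qpoch a (q ^ 2) n * qpoch (a * q) (q ^ 2) n"
proof (induction n)
  case (Suc n)
  have "q ^ (2 * n) = (q ^ 2) ^ n" by (rule power_mult)
  then have "qpoch a q (2 * Suc n)
      = qpoch a q (2 * n) * (1 - a * (q ^ 2) ^ n) * (1 - a * (q * (q ^ 2) ^ n))"
    by (simp add: qpoch_Suc)
  then show ?case
    unfolding Suc.IH by (simp add: qpoch_Suc mult_ac)
qed simp

lemma qpoch_mult_uminus: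
  "qpoch a q n * qpoch (- a) q n = qpoch (a ^ 2) (q ^ 2) n"
proof -
  have "(1 - a * q ^ k) * (1 - (- a) * q ^ k) = 1 - a ^ 2 * (q ^ 2) ^ k" for k
    by (simp add: algebra_simps power2_eq_square power_mult_distrib)
  then show ?thesis by (simp add: qpoch_def flip: prod.distrib)
qed

lemma prod_uminus_powers:
  "(\<Prod>j<n. 0 - q ^ j) = (-1) ^ n * (q::complex) ^ (n choose 2)"
  by (induction n) (simp_all add: Suc_choose_2 binomial_eq_0 power_add)

text \<open>
  Take \<open>u = c\<close>. The diagonal sums vanish for odd \<open>n\<close>, and the series over even \<open>n\<close> remains. The
  condition on \<open>c z\<close> ensures \<open>(c z; q)\<^sub>\<infinity> \<noteq> 0\<close>, so that this factor can be moved to the other side.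
\<close>

lemma ramanujan_A_prod_expansion:
  fixes c z q :: complex
  assumes "norm q < 1" "q \<noteq> 0" and c: "\<And>n. qpoch c q n \<noteq> 0" and "norm (c * z) < 1"
  shows "series_identity
          (\<lambda>n. q ^ (n choose 2) / qpoch q q n * (c * z) ^ n
                * ramanujan_A q (c * q powi (int n - 1)))
          (qpoch_inf c q / qpoch_inf (c * z) q)
          (\<lambda>n. q ^ (n ^ 2 - n) * (\<Prod>j<2 * n. z - q ^ j) * (- (c ^ 2)) ^ n
                / qpochs [q ^ 2, c, c * q] (q ^ 2) n)"
proof -
  let ?C = "qpoch_inf (c * z) q / qpoch_inf c q"
  define f where "f n = (\<Prod>j<n. z - q ^ j) / qpoch c q n
       * (\<Sum>k\<le>n. euler_coeff q (n - k) * c ^ (n - k) * (euler_coeff q k * (- c) ^ k))" for n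
  define g where "g n = euler_coeff q n * (c * z) ^ n * ramanujan_A q (c * q powi (int n - 1))" for n
  have C: "?C \<noteq> 0"
    using qpoch_inf_nz[OF assms(1) c] qpoch_inf_nz[OF assms(1) qpoch_nz_norm_less_1[OF assms(1,4)]]
    by simp
  have "q powi (int n - 1) * q = q ^ n" for n
    using \<open>q \<noteq> 0\<close> by (simp add: power_int_diff)
  then have "series_identity f ?C g"
    unfolding f_def g_def by (intro ramanujan_A_double_expansion assms) (simp add: mult.assoc)
  then have gf: "series_identity g (1 / ?C) f"
    by (rule series_identity_flip) (rule C)
  have f: "f n = (\<Prod>j<n. z - q ^ j) / qpoch c q n * c ^ n
      * (\<Sum>k\<le>n. euler_coeff q (n - k) * (euler_coeff q k * (-1) ^ k))" for n
  proof -
    have "(\<Sum>k\<le>n. euler_coeff q (n - k) * c ^ (n - k) * (euler_coeff q k * (- c) ^ k))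
        = (\<Sum>k\<le>n. c ^ n * (euler_coeff q (n - k) * (euler_coeff q k * (-1) ^ k)))"
    proof (rule sum.cong)
      fix k assume "k \<in> {..n}"
      then have "c ^ (n - k) * (- c) ^ k = c ^ n * (-1) ^ k"
        by (subst power_minus) (simp flip: power_add)
      then show "euler_coeff q (n - k) * c ^ (n - k) * (euler_coeff q k * (- c) ^ k)
          = c ^ n * (euler_coeff q (n - k) * (euler_coeff q k * (-1) ^ k))"
        by (simp add: mult_ac)
    qed simp
    then show ?thesis unfolding f_def sum_distrib_left[symmetric] by simp
  qed
  have even: "f (2 * n) = q ^ (n ^ 2 - n) * (\<Prod>j<2 * n. z - q ^ j) * (- (c ^ 2)) ^ n
                / qpochs [q ^ 2, c, c * q] (q ^ 2) n" for n
  proof -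
    have "(- (c ^ 2)) ^ n = (-1) ^ n * c ^ (2 * n)"
      by (subst power_minus) (simp add: power_mult)
    then show ?thesis
      unfolding f euler_conv_alternating(1)[OF assms(1)] qpoch_even_odd_split
      by (simp add: qpochs_def mult_ac)
  qed
  have odd: "f n = 0" if "n \<notin> range (\<lambda>n. 2 * n)" for n
  proof -
    have "odd n" using that by (auto elim: evenE)
    then obtain m where "n = Suc (2 * m)" by (auto elim: oddE)
    then show ?thesis
      using euler_conv_alternating(2)[OF assms(1), of m] by (simp only: f mult_zero_right)
  qed
  \<comment> \<open>Dropping the vanishing odd terms changes neither convergence nor the sum.\<close>
  have "strict_mono (\<lambda>n::nat. 2 * n)" by (simp add: strict_mono_def)
  then have "(\<lambda>n. f (2 * n)) sums s \<longleftrightarrow> f sums s" for s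
    using odd by (rule sums_mono_reindex)
  then have "series_identity g (1 / ?C) (\<lambda>n. f (2 * n))"
    using gf by (auto simp: series_identity_def summable_def suminf_def)
  then show ?thesis
    unfolding even g_def euler_coeff_def by simp
qed

text \<open>
  Work in base \<open>q\<^sup>2\<close> with \<open>c\<^sup>2 q\<close> in place of \<open>c\<close> and \<open>u = - c\<^sup>2 q\<^sup>2\<close>. Then \<open>u\<close> is \<open>q\<close> times \<open>-c\<^sup>2 q\<close>,
  and the diagonal sum is the convolution of \<open>euler_conv_square_base\<close> times a power of \<open>-c\<^sup>2 q\<close>.
  The denominators factor since \<open>(c\<^sup>2 q; q\<^sup>2)\<^sub>n = (c r; q)\<^sub>n (-c r; q)\<^sub>n\<close> for a square root \<open>r\<close> of \<open>q\<close>.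
\<close>

lemma ramanujan_A_square_base_expansion:
  fixes c z q r :: complex
  assumes "norm q < 1" and r: "r ^ 2 = q"
    and c: "\<And>n. qpochs [q, c * r, - c * r] q n \<noteq> 0" and cz: "norm (c ^ 2 * z * q) < 1"
  shows "series_identity
          (\<lambda>n. q ^ (n ^ 2 + n) * (- (c ^ 2) * z) ^ n / qpoch (q ^ 2) (q ^ 2) n
                * ramanujan_A (q ^ 2) (- (c ^ 2) * q ^ (2 * n)))
          (qpoch_inf (c ^ 2 * q) (q ^ 2) / qpoch_inf (c ^ 2 * z * q) (q ^ 2))
          (\<lambda>n. q ^ (Suc n choose 2) * (\<Prod>j<n. z - q ^ (2 * j)) * (- (c ^ 2)) ^ n
                / qpochs [q, c * r, - c * r] q n)"
proof -
  let ?C = "qpoch_inf (c ^ 2 * q * z) (q ^ 2) / qpoch_inf (c ^ 2 * q) (q ^ 2)"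
  define u where "u = - (c ^ 2) * q ^ 2"
  have q2: "norm (q ^ 2) < 1"
    using assms(1) by (simp add: norm_power power_less_one_iff)
  have prod: "qpoch (c * r) q n * qpoch (- c * r) q n = qpoch (c ^ 2 * q) (q ^ 2) n" for n
    using qpoch_mult_uminus[of "c * r" q n] by (simp add: power_mult_distrib r)
  have nz: "qpoch (c ^ 2 * q) (q ^ 2) n \<noteq> 0" for n
    using c[of n] unfolding prod[symmetric] by (simp add: qpochs_def)
  have "norm (c ^ 2 * q * z) < 1"
    using cz by (simp add: mult_ac)
  from qpoch_inf_nz[OF q2 qpoch_nz_norm_less_1[OF q2 this]] have C: "?C \<noteq> 0"
    using qpoch_inf_nz[OF q2 nz] by simp
  have "series_identity
    (\<lambda>n. (\<Prod>j<n. z - (q ^ 2) ^ j) / qpoch (c ^ 2 * q) (q ^ 2) n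
       * (\<Sum>k\<le>n. euler_coeff (q ^ 2) (n - k) * u ^ (n - k)
            * (euler_coeff (q ^ 2) k * (- (c ^ 2 * q)) ^ k)))
    ?C
    (\<lambda>n. euler_coeff (q ^ 2) n * (u * z) ^ n * ramanujan_A (q ^ 2) (- (c ^ 2) * q ^ (2 * n)))"
    by (intro ramanujan_A_double_expansion q2 nz) (simp add: u_def power_mult)
  from series_identity_flip[OF this C] have "series_identity
    (\<lambda>n. euler_coeff (q ^ 2) n * (u * z) ^ n * ramanujan_A (q ^ 2) (- (c ^ 2) * q ^ (2 * n)))
    (1 / ?C)
    (\<lambda>n. (\<Prod>j<n. z - (q ^ 2) ^ j) / qpoch (c ^ 2 * q) (q ^ 2) n
       * (\<Sum>k\<le>n. euler_coeff (q ^ 2) (n - k) * u ^ (n - k)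
            * (euler_coeff (q ^ 2) k * (- (c ^ 2 * q)) ^ k)))" .
  moreover have "(\<Prod>j<n. z - (q ^ 2) ^ j) / qpoch (c ^ 2 * q) (q ^ 2) n
       * (\<Sum>k\<le>n. euler_coeff (q ^ 2) (n - k) * u ^ (n - k)
            * (euler_coeff (q ^ 2) k * (- (c ^ 2 * q)) ^ k))
      = q ^ (Suc n choose 2) * (\<Prod>j<n. z - q ^ (2 * j)) * (- (c ^ 2)) ^ n
                / qpochs [q, c * r, - c * r] q n" for n
  proof -
    have "(\<Sum>k\<le>n. euler_coeff (q ^ 2) (n - k) * u ^ (n - k)
            * (euler_coeff (q ^ 2) k * (- (c ^ 2 * q)) ^ k))
        = (\<Sum>k\<le>n. (- (c ^ 2 * q)) ^ n
            * (euler_coeff (q ^ 2) (n - k) * q ^ (n - k) * euler_coeff (q ^ 2) k))"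
    proof (rule sum.cong)
      fix k assume "k \<in> {..n}"
      then have "(- (c ^ 2 * q)) ^ n = (- (c ^ 2 * q)) ^ (n - k) * (- (c ^ 2 * q)) ^ k"
        by (simp flip: power_add)
      moreover have "u ^ (n - k) = (- (c ^ 2 * q)) ^ (n - k) * q ^ (n - k)"
        by (simp add: u_def power2_eq_square mult_ac flip: power_mult_distrib)
      ultimately show "euler_coeff (q ^ 2) (n - k) * u ^ (n - k)
            * (euler_coeff (q ^ 2) k * (- (c ^ 2 * q)) ^ k)
          = (- (c ^ 2 * q)) ^ n
            * (euler_coeff (q ^ 2) (n - k) * q ^ (n - k) * euler_coeff (q ^ 2) k)"
        by (simp only: mult_ac)
    qed simp
    also have "\<dots> = (- (c ^ 2 * q)) ^ n * euler_coeff q n"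
      by (simp only: euler_conv_square_base[OF assms(1)] flip: sum_distrib_left)
    also have "(- (c ^ 2 * q)) ^ n = (- (c ^ 2)) ^ n * q ^ n"
      by (simp flip: power_mult_distrib)
    finally have inner: "(\<Sum>k\<le>n. euler_coeff (q ^ 2) (n - k) * u ^ (n - k)
            * (euler_coeff (q ^ 2) k * (- (c ^ 2 * q)) ^ k))
        = (- (c ^ 2)) ^ n * q ^ n * euler_coeff q n" .
    show ?thesis
      unfolding inner prod[symmetric] power_mult[of q 2]
      by (simp add: qpochs_def euler_coeff_def Suc_choose_2 power_add mult_ac)
  qed
  moreover have "euler_coeff (q ^ 2) n * (u * z) ^ n
      = q ^ (n ^ 2 + n) * (- (c ^ 2) * z) ^ n / qpoch (q ^ 2) (q ^ 2) n" for n
  proof -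
    have "u * z = q ^ 2 * (- (c ^ 2) * z)"
      by (simp add: u_def)
    moreover have "n ^ 2 + n = 2 * (n choose 2) + 2 * n"
      by (simp add: power2_eq_choose)
    ultimately show ?thesis
      by (simp only: euler_coeff_def power_mult_distrib power_add power_mult) simp
  qed
  moreover have "1 / ?C = qpoch_inf (c ^ 2 * q) (q ^ 2) / qpoch_inf (c ^ 2 * z * q) (q ^ 2)"
    by (simp add: mult_ac)
  ultimately show ?thesis by (simp only:)
qed

text \<open>
  Reads a closed form off a series identity whose left-hand side has collapsed to its first term,
  as happens for \<open>z = 0\<close>.
\<close>

lemma series_identity_single:
  assumes "series_identity (\<lambda>n. if n = 0 then x else 0) C g"
  shows "summable g \<and> x = C * (\<Sum>n. g n)"
  using assms sums_single[of 0 "\<lambda>_. x"] by (simp add: series_identity_def sums_iff)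

text \<open>
  The case \<open>z = 0\<close> with \<open>c q\<close> for \<open>c\<close>, which turns the argument \<open>c q\<^bsup>-1\<^esup>\<close> of the only remaining
  Ramanujan function into \<open>c\<close>. The exponents on the other side add up to
  \<open>(n\<^sup>2 - n) + (2 n choose 2) + 2 n = 3 n\<^sup>2\<close>.
\<close>

lemma ramanujan_A_expansion_at_0:
  fixes c q :: complex
  assumes "norm q < 1" "q \<noteq> 0" and c: "\<And>n. qpoch (c * q) q n \<noteq> 0"
  shows "summable (\<lambda>n. q ^ (3 * n ^ 2) * (- (c ^ 2)) ^ n / qpochs [q ^ 2, c * q, c * q ^ 2] (q ^ 2) n)
    \<and> ramanujan_A q c = qpoch_inf (c * q) q
      * (\<Sum>n. q ^ (3 * n ^ 2) * (- (c ^ 2)) ^ n / qpochs [q ^ 2, c * q, c * q ^ 2] (q ^ 2) n)"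
proof (rule series_identity_single)
  have "q ^ (n choose 2) / qpoch q q n * (c * q * 0) ^ n
        * ramanujan_A q (c * q * q powi (int n - 1)) = (if n = 0 then ramanujan_A q c else 0)" for n
  proof (cases "n = 0")
    case True
    with \<open>q \<noteq> 0\<close> show ?thesis
      by (simp add: binomial_eq_0 mult.assoc)
  qed simp
  moreover have "q ^ (n ^ 2 - n) * (\<Prod>j<2 * n. 0 - q ^ j) * (- ((c * q) ^ 2)) ^ n
        / qpochs [q ^ 2, c * q, c * q * q] (q ^ 2) n
      = q ^ (3 * n ^ 2) * (- (c ^ 2)) ^ n / qpochs [q ^ 2, c * q, c * q ^ 2] (q ^ 2) n" for n
  proof -
    have "- ((c * q) ^ 2) = - (c ^ 2) * q ^ 2"
      by (simp add: power_mult_distrib)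
    then have 1: "(- ((c * q) ^ 2)) ^ n = (- (c ^ 2)) ^ n * q ^ (2 * n)"
      by (simp only: power_mult_distrib power_mult)
    have "(2 * n) ^ 2 = 4 * n ^ 2" "n \<le> n ^ 2"
      by (auto simp: power2_eq_square)
    then have 2: "3 * n ^ 2 = (n ^ 2 - n) + (2 * n choose 2) + 2 * n"
      using power2_eq_choose[of "2 * n"] by linarith
    have 3: "c * q * q = c * q ^ 2"
      by (simp add: power2_eq_square)
    show ?thesis
      unfolding prod_uminus_powers 1 2 3 by (simp add: power_add)
  qed
  moreover have "norm (c * q * 0) < 1" by simp
  note ramanujan_A_prod_expansion[OF assms this]
  ultimately show "series_identity (\<lambda>n. if n = 0 then ramanujan_A q c else 0) (qpoch_inf (c * q) q)
    (\<lambda>n. q ^ (3 * n ^ 2) * (- (c ^ 2)) ^ n / qpochs [q ^ 2, c * q, c * q ^ 2] (q ^ 2) n)"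
    by (simp only: mult_zero_right qpoch_inf_0 div_by_1)
qed

lemma ramanujan_A_square_base_expansion_at_0:
  fixes c q r :: complex
  assumes "norm q < 1" and "r ^ 2 = q" and "\<And>n. qpochs [q, c * r, - c * r] q n \<noteq> 0"
  shows "summable (\<lambda>n. q ^ ((3 * n ^ 2 - n) div 2) * c ^ (2 * n) / qpochs [q, c * r, - c * r] q n)
    \<and> ramanujan_A (q ^ 2) (- (c ^ 2)) = qpoch_inf (c ^ 2 * q) (q ^ 2)
      * (\<Sum>n. q ^ ((3 * n ^ 2 - n) div 2) * c ^ (2 * n) / qpochs [q, c * r, - c * r] q n)"
proof (rule series_identity_single)
  have "q ^ (n ^ 2 + n) * (- (c ^ 2) * 0) ^ n / qpoch (q ^ 2) (q ^ 2) n
        * ramanujan_A (q ^ 2) (- (c ^ 2) * q ^ (2 * n))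
      = (if n = 0 then ramanujan_A (q ^ 2) (- (c ^ 2)) else 0)" for n
    by simp
  moreover have "q ^ (Suc n choose 2) * (\<Prod>j<n. 0 - q ^ (2 * j)) * (- (c ^ 2)) ^ n
      = q ^ ((3 * n ^ 2 - n) div 2) * c ^ (2 * n)" for n
  proof -
    have "(\<Prod>j<n. 0 - q ^ (2 * j)) = (-1) ^ n * q ^ (2 * (n choose 2))"
      using prod_uminus_powers[of "q ^ 2" n] by (simp add: power_mult)
    moreover have "(- (c ^ 2)) ^ n = (-1) ^ n * c ^ (2 * n)"
      by (subst power_minus) (simp add: power_mult)
    moreover have "(3 * n ^ 2 - n) div 2 = (Suc n choose 2) + 2 * (n choose 2)"
      unfolding power2_eq_choose[of n] Suc_choose_2 by simp
    ultimately show ?thesis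
      by (simp add: power_add mult_ac flip: power_mult_distrib)
  qed
  moreover have "norm (c ^ 2 * 0 * q) < 1" by simp
  note ramanujan_A_square_base_expansion[OF assms this]
  ultimately show "series_identity (\<lambda>n. if n = 0 then ramanujan_A (q ^ 2) (- (c ^ 2)) else 0)
    (qpoch_inf (c ^ 2 * q) (q ^ 2))
    (\<lambda>n. q ^ ((3 * n ^ 2 - n) div 2) * c ^ (2 * n) / qpochs [q, c * r, - c * r] q n)"
    by (simp only: mult_zero_left mult_zero_right qpoch_inf_0 div_by_1)
qed

section \<open>The five identities\<close>

theorem theorem4p4:
  fixes q :: real and Q :: complex
  assumes "0 < q" and "q < 1" and "Q = complex_of_real q"
  shows
    "(\<forall>a b c :: complex.
        a \<noteq> 0 \<longrightarrow> b \<noteq> 0 \<longrightarrow> (\<forall>n. qpoch c Q n \<noteq> 0) \<longrightarrow> norm (c / (a * b)) < 1 \<longrightarrow>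
        series_identity
          (\<lambda>n. qpoch b Q n * complex_of_real (q powr (real n ^ 2 / 2))
                * stieltjes_wigert n (a * complex_of_real (q powr (- real n - 1 / 2))) Q
                / qpoch c Q n * (c / (a * b)) ^ n)
          (qpoch_inf (c / b) Q / qpoch_inf c Q)
          (\<lambda>n. complex_of_real (q powr (real n ^ 2 / 2)) / qpoch Q Q n * (c / (a * b)) ^ n
                * ramanujan_A Q (c * complex_of_real (q powr (real n - 1 / 2)) / a)))
   \<and> (\<forall>c z :: complex.
        (\<forall>n. qpochs [Q ^ 2, c, c * Q] (Q ^ 2) n \<noteq> 0) \<longrightarrow> norm (c * z) < sqrt q \<longrightarrow>
        series_identity
          (\<lambda>n. Q ^ (n choose 2) / qpoch Q Q n * (c * z) ^ n
                * ramanujan_A Q (c * Q powi (int n - 1)))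
          (qpoch_inf c Q / qpoch_inf (c * z) Q)
          (\<lambda>n. Q ^ (n ^ 2 - n) * (\<Prod>j<2 * n. z - Q ^ j) * (- (c ^ 2)) ^ n
                / qpochs [Q ^ 2, c, c * Q] (Q ^ 2) n))
   \<and> (\<forall>c :: complex.
        (\<forall>n. qpochs [Q ^ 2, c * Q, c * Q ^ 2] (Q ^ 2) n \<noteq> 0) \<longrightarrow>
        summable (\<lambda>n. Q ^ (3 * n ^ 2) * (- (c ^ 2)) ^ n
                       / qpochs [Q ^ 2, c * Q, c * Q ^ 2] (Q ^ 2) n) \<and>
        ramanujan_A Q c = qpoch_inf (c * Q) Q
          * (\<Sum>n. Q ^ (3 * n ^ 2) * (- (c ^ 2)) ^ n
                   / qpochs [Q ^ 2, c * Q, c * Q ^ 2] (Q ^ 2) n))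
   \<and> (\<forall>c z :: complex.
        (\<forall>n. qpochs [Q, c * complex_of_real (sqrt q), - c * complex_of_real (sqrt q)] Q n \<noteq> 0) \<longrightarrow>
        norm (c ^ 2 * z) < 1 / q \<longrightarrow>
        series_identity
          (\<lambda>n. Q ^ (n ^ 2 + n) * (- (c ^ 2) * z) ^ n / qpoch (Q ^ 2) (Q ^ 2) n
                * ramanujan_A (Q ^ 2) (- (c ^ 2) * Q ^ (2 * n)))
          (qpoch_inf (c ^ 2 * Q) (Q ^ 2) / qpoch_inf (c ^ 2 * z * Q) (Q ^ 2))
          (\<lambda>n. Q ^ (Suc n choose 2) * (\<Prod>j<n. z - Q ^ (2 * j)) * (- (c ^ 2)) ^ n
                / qpochs [Q, c * complex_of_real (sqrt q), - c * complex_of_real (sqrt q)] Q n))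
   \<and> (\<forall>c :: complex.
        (\<forall>n. qpochs [Q, c * complex_of_real (sqrt q), - c * complex_of_real (sqrt q)] Q n \<noteq> 0) \<longrightarrow>
        summable (\<lambda>n. Q ^ ((3 * n ^ 2 - n) div 2) * c ^ (2 * n)
                       / qpochs [Q, c * complex_of_real (sqrt q), - c * complex_of_real (sqrt q)] Q n) \<and>
        ramanujan_A (Q ^ 2) (- (c ^ 2)) = qpoch_inf (c ^ 2 * Q) (Q ^ 2)
          * (\<Sum>n. Q ^ ((3 * n ^ 2 - n) div 2) * c ^ (2 * n)
                   / qpochs [Q, c * complex_of_real (sqrt q), - c * complex_of_real (sqrt q)] Q n))"
proof (intro conjI allI impI)
  have Q1: "norm Q < 1" and Q0: "Q \<noteq> 0"
    using assms by auto
  have even_odd_nz: "qpoch c Q n \<noteq> 0"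
    if "\<And>n. qpochs [Q ^ 2, c, c * Q] (Q ^ 2) n \<noteq> 0" for c n
  proof -
    \<comment> \<open>\<open>(c; q)\<^bsub>2n\<^esub>\<close> contains \<open>(c; q)\<^sub>n\<close> as a factor and splits into the two given products in base \<open>q\<^sup>2\<close>.\<close>
    have "qpoch c Q (n + n) \<noteq> 0"
      using that[of n] qpoch_even_odd_split[of c Q n] by (simp add: qpochs_def mult_2)
    then show ?thesis by (simp add: qpoch_add)
  qed
  have sqrt: "complex_of_real (sqrt q) ^ 2 = Q"
    using assms by (simp flip: of_real_power)
  fix c :: complex
  {
    fix a b :: complex
    assume "a \<noteq> 0" "b \<noteq> 0" "\<forall>n. qpoch c Q n \<noteq> 0"
    then show "series_identity
          (\<lambda>n. qpoch b Q n * complex_of_real (q powr (real n ^ 2 / 2))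
                * stieltjes_wigert n (a * complex_of_real (q powr (- real n - 1 / 2))) Q
                / qpoch c Q n * (c / (a * b)) ^ n)
          (qpoch_inf (c / b) Q / qpoch_inf c Q)
          (\<lambda>n. complex_of_real (q powr (real n ^ 2 / 2)) / qpoch Q Q n * (c / (a * b)) ^ n
                * ramanujan_A Q (c * complex_of_real (q powr (real n - 1 / 2)) / a))"
      by (intro stieltjes_wigert_series_identity assms) auto
  next
    fix z :: complex
    assume nz: "\<forall>n. qpochs [Q ^ 2, c, c * Q] (Q ^ 2) n \<noteq> 0" and z: "norm (c * z) < sqrt q"
    have "norm (c * z) < 1"
      using z assms real_sqrt_lt_1_iff[of q] by linarith
    then show "series_identity
          (\<lambda>n. Q ^ (n choose 2) / qpoch Q Q n * (c * z) ^ n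
                * ramanujan_A Q (c * Q powi (int n - 1)))
          (qpoch_inf c Q / qpoch_inf (c * z) Q)
          (\<lambda>n. Q ^ (n ^ 2 - n) * (\<Prod>j<2 * n. z - Q ^ j) * (- (c ^ 2)) ^ n
                / qpochs [Q ^ 2, c, c * Q] (Q ^ 2) n)"
      using nz by (intro ramanujan_A_prod_expansion Q1 Q0 even_odd_nz) auto
  next
    assume "\<forall>n. qpochs [Q ^ 2, c * Q, c * Q ^ 2] (Q ^ 2) n \<noteq> 0"
    then have "qpoch (c * Q) Q n \<noteq> 0" for n
      by (intro even_odd_nz) (simp add: power2_eq_square mult.assoc)
    note special = ramanujan_A_expansion_at_0[OF Q1 Q0 this]
    show "summable (\<lambda>n. Q ^ (3 * n ^ 2) * (- (c ^ 2)) ^ n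
                       / qpochs [Q ^ 2, c * Q, c * Q ^ 2] (Q ^ 2) n)"
      and "ramanujan_A Q c = qpoch_inf (c * Q) Q
          * (\<Sum>n. Q ^ (3 * n ^ 2) * (- (c ^ 2)) ^ n
                   / qpochs [Q ^ 2, c * Q, c * Q ^ 2] (Q ^ 2) n)"
      using special by blast+
  next
    fix z :: complex
    assume nz: "\<forall>n. qpochs [Q, c * complex_of_real (sqrt q), - c * complex_of_real (sqrt q)] Q n \<noteq> 0"
      and z: "norm (c ^ 2 * z) < 1 / q"
    have "norm (c ^ 2 * z * Q) = norm (c ^ 2 * z) * q"
      using assms by (simp add: norm_mult)
    then have "norm (c ^ 2 * z * Q) < 1"
      using z assms by (simp only: pos_less_divide_eq)
    then show "series_identity
          (\<lambda>n. Q ^ (n ^ 2 + n) * (- (c ^ 2) * z) ^ n / qpoch (Q ^ 2) (Q ^ 2) n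
                * ramanujan_A (Q ^ 2) (- (c ^ 2) * Q ^ (2 * n)))
          (qpoch_inf (c ^ 2 * Q) (Q ^ 2) / qpoch_inf (c ^ 2 * z * Q) (Q ^ 2))
          (\<lambda>n. Q ^ (Suc n choose 2) * (\<Prod>j<n. z - Q ^ (2 * j)) * (- (c ^ 2)) ^ n
                / qpochs [Q, c * complex_of_real (sqrt q), - c * complex_of_real (sqrt q)] Q n)"
      using nz by (intro ramanujan_A_square_base_expansion Q1 sqrt) auto
  next
    assume "\<forall>n. qpochs [Q, c * complex_of_real (sqrt q), - c * complex_of_real (sqrt q)] Q n \<noteq> 0"
    then have nz: "qpochs [Q, c * complex_of_real (sqrt q), - c * complex_of_real (sqrt q)] Q n \<noteq> 0" for n
      by blast
    note special = ramanujan_A_square_base_expansion_at_0[OF Q1 sqrt nz]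
    show "summable (\<lambda>n. Q ^ ((3 * n ^ 2 - n) div 2) * c ^ (2 * n)
                       / qpochs [Q, c * complex_of_real (sqrt q), - c * complex_of_real (sqrt q)] Q n)"
      and "ramanujan_A (Q ^ 2) (- (c ^ 2)) = qpoch_inf (c ^ 2 * Q) (Q ^ 2)
          * (\<Sum>n. Q ^ ((3 * n ^ 2 - n) div 2) * c ^ (2 * n)
                   / qpochs [Q, c * complex_of_real (sqrt q), - c * complex_of_real (sqrt q)] Q n)"
      using special by blast+
  }
qed

end
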